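(* Let $W$ be a finite group and $V$ a finite dimensional representation of $W$. Then the ring $\mathcal{D}(V\oplus V^* )^W$ is generated by $\mathcal{D}(V\oplus0)^W\cup\mathcal{D}(0\oplus V^* )^W\cup\{\omega\}$, where $\omega:V\times V^*\to\mathbb{C}$ is the evaluation map.
   Context: $\mathcal{D}(V\oplus V^* )$ is the Weyl algebra of polynomial differential operators on $V\oplus V^*$, with $W$ acting diagonally by conjugation. $\mathcal{D}(V\oplus0)$ denotes the subalgebra generated by polynomial functions of the $V$-coordinates and derivatives in the $V$-directions (i.e. $\mathcal{D}(V)\otimes1\subseteq\mathcal{D}(V)\otimes\mathcal{D}(V^* )=\mathcal{D}(V\oplus V^* )$), and similarly $\mathcal{D}(0\oplus V^* )$. The evaluation map $\omega(v,\lambda)=\lambda(v)$ is regarded as a polynomial function, i.e. an operator of order $0$. *)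

theory Defs
  imports "HOL-Analysis.Analysis" "HOL-Algebra.Group"
begin

text \<open>Points of V \<oplus> V* with V = complex^'n (coordinates w.r.t. a basis of V,
  and the dual basis of V*).  Functions and operators on them.\<close>

type_synonym 'n pt = "(complex^'n) \<times> (complex^'n)"
type_synonym 'n fn = "'n pt \<Rightarrow> complex"
type_synonym 'n op = "'n fn \<Rightarrow> 'n fn"

inductive_set polyfun :: "('n::finite) fn set" where
  pf_const: "(\<lambda>p. c) \<in> polyfun"
| pf_xcoord: "(\<lambda>p. fst p $ i) \<in> polyfun"
| pf_ycoord: "(\<lambda>p. snd p $ i) \<in> polyfun"
| pf_add: "f \<in> polyfun \<Longrightarrow> g \<in> polyfun \<Longrightarrow> (\<lambda>p. f p + g p) \<in> polyfun"
| pf_mult: "f \<in> polyfun \<Longrightarrow> g \<in> polyfun \<Longrightarrow> (\<lambda>p. f p * g p) \<in> polyfun"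

text \<open>Operators are identified with their action on polynomial functions
  (the Weyl algebra acts faithfully there); outside we normalise to 0.\<close>
definition res :: "('n::finite) op \<Rightarrow> 'n op" where
  "res T = (\<lambda>f. if f \<in> polyfun then T f else (\<lambda>p. 0))"

definition mult_op :: "('n::finite) fn \<Rightarrow> 'n op" where
  "mult_op h = res (\<lambda>f p. h p * f p)"

definition dx_op :: "'n::finite \<Rightarrow> 'n op" where
  "dx_op i = res (\<lambda>f p. deriv (\<lambda>t. f (fst p + t *s axis i 1, snd p)) 0)"

definition dy_op :: "'n::finite \<Rightarrow> 'n op" where
  "dy_op i = res (\<lambda>f p. deriv (\<lambda>t. f (fst p, snd p + t *s axis i 1)) 0)"

inductive_set ring_gen :: "('n::finite) op set \<Rightarrow> 'n op set" for S where
  rg_base: "T \<in> S \<Longrightarrow> T \<in> ring_gen S"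
| rg_one: "res id \<in> ring_gen S"
| rg_add: "T \<in> ring_gen S \<Longrightarrow> U \<in> ring_gen S \<Longrightarrow> res (\<lambda>f p. T f p + U f p) \<in> ring_gen S"
| rg_neg: "T \<in> ring_gen S \<Longrightarrow> res (\<lambda>f p. - T f p) \<in> ring_gen S"
| rg_comp: "T \<in> ring_gen S \<Longrightarrow> U \<in> ring_gen S \<Longrightarrow> res (T \<circ> U) \<in> ring_gen S"

definition scalars :: "('n::finite) op set" where
  "scalars = {mult_op (\<lambda>p. c) | c. True}"

definition weyl_full :: "('n::finite) op set" where
  "weyl_full = ring_gen (scalars \<union> range (\<lambda>i. mult_op (\<lambda>p. fst p $ i)) \<union> range dx_op
                        \<union> range (\<lambda>i. mult_op (\<lambda>p. snd p $ i)) \<union> range dy_op)"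

definition weyl_V :: "('n::finite) op set" where
  "weyl_V = ring_gen (scalars \<union> range (\<lambda>i. mult_op (\<lambda>p. fst p $ i)) \<union> range dx_op)"

definition weyl_Vdual :: "('n::finite) op set" where
  "weyl_Vdual = ring_gen (scalars \<union> range (\<lambda>i. mult_op (\<lambda>p. snd p $ i)) \<union> range dy_op)"

definition omega_op :: "('n::finite) op" where
  "omega_op = mult_op (\<lambda>p. \<Sum>i\<in>UNIV. fst p $ i * snd p $ i)"

text \<open>Representation rho : W -> GL(V) (matrices); W acts diagonally on V \<oplus> V*,
  on V* by the contragredient action (transpose of rho(g^-1) on dual coordinates).\<close>
definition is_rep :: "('g, 'b) monoid_scheme \<Rightarrow> ('g \<Rightarrow> complex^'n^'n) \<Rightarrow> bool" where
  "is_rep W \<rho> \<longleftrightarrow> \<rho> \<one>\<^bsub>W\<^esub> = mat 1 \<and>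
     (\<forall>g\<in>carrier W. \<forall>h\<in>carrier W. \<rho> (g \<otimes>\<^bsub>W\<^esub> h) = \<rho> g ** \<rho> h)"

definition pt_act :: "('g, 'b) monoid_scheme \<Rightarrow> ('g \<Rightarrow> complex^'n^'n) \<Rightarrow> 'g \<Rightarrow> ('n::finite) pt \<Rightarrow> 'n pt" where
  "pt_act W \<rho> g p = (\<rho> g *v fst p, transpose (\<rho> (inv\<^bsub>W\<^esub> g)) *v snd p)"

definition fn_act :: "('g, 'b) monoid_scheme \<Rightarrow> ('g \<Rightarrow> complex^'n^'n) \<Rightarrow> 'g \<Rightarrow> ('n::finite) fn \<Rightarrow> 'n fn" where
  "fn_act W \<rho> g f = (\<lambda>p. f (pt_act W \<rho> (inv\<^bsub>W\<^esub> g) p))"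

definition op_act :: "('g, 'b) monoid_scheme \<Rightarrow> ('g \<Rightarrow> complex^'n^'n) \<Rightarrow> 'g \<Rightarrow> ('n::finite) op \<Rightarrow> 'n op" where
  "op_act W \<rho> g T = res (\<lambda>f. fn_act W \<rho> g (T (fn_act W \<rho> (inv\<^bsub>W\<^esub> g) f)))"

definition invariants :: "('g, 'b) monoid_scheme \<Rightarrow> ('g \<Rightarrow> complex^'n^'n) \<Rightarrow> ('n::finite) op set \<Rightarrow> 'n op set" where
  "invariants W \<rho> A = {T \<in> A. \<forall>g\<in>carrier W. op_act W \<rho> g T = T}"

end

theory Submission
  imports Defs
begin

text \<open>
  Only the image \<open>M\<close> of \<open>W\<close> in \<open>GL(V)\<close> matters. Put \<open>C = D(V \<oplus> V*)\<close>, let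
  \<open>G = M \<times> M\<close> act factorwise on \<open>C = D(V) \<otimes> D(V*)\<close>, and let \<open>R\<close> be the ring on the
  right-hand side. Averaging over \<open>G\<close> puts \<open>C\<^sup>G = D(V)\<^sup>M \<otimes> D(V*)\<^sup>M\<close> inside \<open>R\<close>. The
  conjugates \<open>\<omega>\<^sub>m\<close> of \<open>\<omega>\<close> under the first factor are pairwise distinct, and
  \<open>F(t) = \<Prod>\<^sub>m (t - \<omega>\<^sub>m)\<close> has coefficients in \<open>C\<^sup>G\<close>, so \<open>f(t) = F(t) / (t - \<omega>)\<close> has
  coefficients \<open>f\<^sub>j\<close> in \<open>R\<close>. Since \<open>f\<close> vanishes at every \<open>\<omega>\<^sub>m\<close> except \<open>\<omega>\<close>, every
  \<open>c \<in> C\<^sup>W\<close> satisfies \<open>f(\<omega>) c = \<Sum>\<^sub>j f\<^sub>j \<Sum>\<^sub>m m(\<omega>\<^sup>j c)\<close>, and the inner sums lie in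
  \<open>C\<^sup>G\<close>. Hence \<open>\<Delta> C\<^sup>W \<subseteq> R\<close> for the discriminant \<open>\<Delta>\<close> of \<open>F\<close>, a nonzero
  \<open>G\<close>-invariant polynomial.

  It remains to see that \<open>1\<close> lies in \<open>C\<^sup>G \<Delta> C\<^sup>G\<close>, which is the argument for simplicity of
  \<open>C\<^sup>G\<close>: among the functions \<open>\<gamma> \<mapsto> \<Sum>\<^sub>i c\<^sub>i \<Delta> \<gamma>(d\<^sub>i)\<close> on \<open>G\<close>, twisted commutators with
  coordinates produce one that is supported at the identity with a nonzero polynomial value,
  commutators with derivatives reduce that value to a nonzero constant, and summing over \<open>G\<close> on
  both sides replaces \<open>c\<^sub>i, d\<^sub>i\<close> by their traces.
\<close>

section \<open>Polynomial functions and directional derivatives\<close>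

definition line :: "('n::finite) pt \<Rightarrow> 'n pt \<Rightarrow> complex \<Rightarrow> 'n pt" where
  "line p v t = (fst p + t *s fst v, snd p + t *s snd v)"

text \<open>Derivatives are taken along arbitrary vectors because a matrix sends basis directions to
  arbitrary ones; by \<open>op_conj_d\<close> conjugation stays within this family.\<close>

definition dd :: "('n::finite) pt \<Rightarrow> 'n op" where
  "dd v f p = deriv (\<lambda>t. f (line p v t)) 0"

lemma line_0 [simp]: "line p v 0 = p"
  by (simp add: line_def)

lemma line_line: "line (line p v s) v t = line p v (s + t)"
  by (simp add: line_def vec_eq_iff algebra_simps)

lemma line_diff: "line p (q - p) 1 = q"
  by (simp add: line_def prod_eq_iff vec_eq_iff)

lemma dx_op_eq: "dx_op i = res (dd (axis i 1, 0))"
  unfolding dx_op_def by (rule arg_cong[of _ _ res]) (simp add: fun_eq_iff dd_def line_def)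

lemma dy_op_eq: "dy_op i = res (dd (0, axis i 1))"
  unfolding dy_op_def by (rule arg_cong[of _ _ res]) (simp add: fun_eq_iff dd_def line_def)

lemma polyfun_sum: "(\<And>i. i \<in> I \<Longrightarrow> f i \<in> polyfun) \<Longrightarrow> (\<lambda>p. \<Sum>i\<in>I. f i p) \<in> polyfun"
  by (induction I rule: infinite_finite_induct) (auto intro: polyfun.intros)

lemma polyfun_prod: "(\<And>i. i \<in> I \<Longrightarrow> f i \<in> polyfun) \<Longrightarrow> (\<lambda>p. \<Prod>i\<in>I. f i p) \<in> polyfun"
  by (induction I rule: infinite_finite_induct) (auto intro: polyfun.intros)

lemma polyfun_cmult: "f \<in> polyfun \<Longrightarrow> (\<lambda>p. c * f p) \<in> polyfun"
  by (intro polyfun.intros)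

lemma polyfun_uminus: "f \<in> polyfun \<Longrightarrow> (\<lambda>p. - f p) \<in> polyfun"
  using polyfun_cmult[of f "-1"] by simp

lemma polyfun_diff: "f \<in> polyfun \<Longrightarrow> g \<in> polyfun \<Longrightarrow> (\<lambda>p. f p - g p) \<in> polyfun"
  using pf_add[OF _ polyfun_uminus, of f g] by simp

lemma polyfun_power: "f \<in> polyfun \<Longrightarrow> (\<lambda>p. f p ^ k) \<in> polyfun"
  by (induction k) (auto intro: polyfun.intros)

lemmas polyfun_intros = polyfun.intros polyfun_sum polyfun_prod polyfun_cmult polyfun_uminus
  polyfun_diff polyfun_power

text \<open>Restriction to a line gives a univariate polynomial; differentiability and the absence
  of zero divisors are both read off there.\<close>

lemma polyfun_line:
  assumes "f \<in> polyfun"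
  obtains P where "\<And>t. f (line p v t) = poly P t"
proof -
  have "\<exists>P. \<forall>t. f (line p v t) = poly P t"
    using assms
  proof induction
    case (pf_const c)
    then show ?case by (intro exI[of _ "[:c:]"]) simp
  next
    case (pf_xcoord i)
    then show ?case
      by (intro exI[of _ "[:fst p $ i, fst v $ i:]"]) (simp add: line_def)
  next
    case (pf_ycoord i)
    then show ?case
      by (intro exI[of _ "[:snd p $ i, snd v $ i:]"]) (simp add: line_def)
  next
    case (pf_add f g)
    then show ?case by (metis poly_add)
  next
    case (pf_mult f g)
    then show ?case by (metis poly_mult)
  qed
  then show ?thesis using that by blast
qed

text \<open>A line joining a point where \<open>f\<close> is nonzero to one where \<open>g\<close>
  is nonzero gives two nonzero univariate restrictions with zero product.\<close>

lemma polyfun_mult_eq_0: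
  assumes "f \<in> polyfun" "g \<in> polyfun" and fg: "(\<lambda>p. f p * g p) = (\<lambda>p. 0)"
  shows "f = (\<lambda>p. 0) \<or> g = (\<lambda>p. 0)"
proof (rule ccontr)
  assume "\<not> ?thesis"
  then obtain p q where pq: "f p \<noteq> 0" "g q \<noteq> 0" by force
  obtain P where P: "\<And>t. f (line p (q - p) t) = poly P t"
    using polyfun_line assms(1) by blast
  obtain Q where Q: "\<And>t. g (line p (q - p) t) = poly Q t"
    using polyfun_line assms(2) by blast
  have "poly (P * Q) t = 0" for t
    using fun_cong[OF fg, of "line p (q - p) t"] by (simp add: P Q)
  then have "P * Q = 0" using poly_all_0_iff_0 by blast
  moreover have "P \<noteq> 0" using P[of 0] pq by auto
  moreover have "Q \<noteq> 0" using Q[of 1] pq by (auto simp: line_diff)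
  ultimately show False by simp
qed

lemma polyfun_prod_nonzero:
  assumes "\<And>i. i \<in> I \<Longrightarrow> f i \<in> polyfun" "\<And>i. i \<in> I \<Longrightarrow> f i \<noteq> (\<lambda>p. 0)"
  shows "(\<lambda>p. \<Prod>i\<in>I. f i p) \<noteq> (\<lambda>p. 0)"
  using assms
proof (induction I rule: infinite_finite_induct)
  case (insert i I)
  then have "(\<lambda>p. f i p * (\<Prod>i\<in>I. f i p)) \<noteq> (\<lambda>p. 0)"
    using polyfun_mult_eq_0[of "f i" "\<lambda>p. \<Prod>i\<in>I. f i p"] by (auto intro: polyfun_prod)
  with insert.hyps show ?case by simp
qed (auto simp: fun_eq_iff)

lemma polyfun_has_dd:
  assumes "f \<in> polyfun"
  shows "((\<lambda>t. f (line p v t)) has_field_derivative dd v f (line p v t)) (at t)"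
proof -
  obtain P where P: "\<And>t. f (line p v t) = poly P t"
    using polyfun_line assms by blast
  \<comment> \<open>\<open>dd\<close> is a derivative at parameter 0, so the base point is moved to
    parameter \<open>t\<close> by composing \<open>P\<close> with \<open>t + s\<close>.\<close>
  have "f (line (line p v t) v s) = poly (pcompose P [:t, 1:]) s" for s
    using P[of "t + s"] by (simp add: line_line poly_pcompose)
  then have "dd v f (line p v t) = deriv (poly (pcompose P [:t, 1:])) 0"
    by (simp add: dd_def)
  also have "\<dots> = poly (pderiv P) t"
    by (simp add: DERIV_imp_deriv[OF poly_DERIV] pderiv_pcompose poly_pcompose pderiv_pCons)
  finally show ?thesis
    using poly_DERIV[of P t] by (simp add: P[abs_def])
qed

lemma polyfun_has_dd_0:
  "f \<in> polyfun \<Longrightarrow> ((\<lambda>t. f (line p v t)) has_field_derivative dd v f p) (at 0)"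
  using polyfun_has_dd[of f p v 0] by simp

lemma dd_const [simp]: "dd v (\<lambda>p. c) = (\<lambda>p. 0)"
  by (simp add: dd_def fun_eq_iff)

lemma dd_x [simp]: "dd v (\<lambda>p. fst p $ i) = (\<lambda>p. fst v $ i)"
  by (auto simp: dd_def line_def fun_eq_iff intro!: DERIV_imp_deriv derivative_eq_intros)

lemma dd_y [simp]: "dd v (\<lambda>p. snd p $ i) = (\<lambda>p. snd v $ i)"
  by (auto simp: dd_def line_def fun_eq_iff intro!: DERIV_imp_deriv derivative_eq_intros)

lemma dd_add:
  "f \<in> polyfun \<Longrightarrow> g \<in> polyfun \<Longrightarrow> dd v (\<lambda>p. f p + g p) = (\<lambda>p. dd v f p + dd v g p)"
  by (rule ext, subst dd_def)
    (rule DERIV_imp_deriv, rule DERIV_add; rule polyfun_has_dd_0)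

lemma dd_mult:
  assumes "f \<in> polyfun" "g \<in> polyfun"
  shows "dd v (\<lambda>p. f p * g p) = (\<lambda>p. dd v f p * g p + f p * dd v g p)"
proof
  fix p
  have "((\<lambda>t. f (line p v t) * g (line p v t)) has_field_derivative
      dd v f p * g p + f p * dd v g p) (at 0)"
    using DERIV_mult'[OF polyfun_has_dd_0 polyfun_has_dd_0, OF assms, of p v p v]
    by (simp add: algebra_simps)
  then show "dd v (\<lambda>p. f p * g p) p = dd v f p * g p + f p * dd v g p"
    by (simp add: dd_def DERIV_imp_deriv)
qed

lemma polyfun_dd: "f \<in> polyfun \<Longrightarrow> dd v f \<in> polyfun"
  by (induction rule: polyfun.induct) (auto simp: dd_add dd_mult intro: polyfun_intros)

lemma dd_cmult: "f \<in> polyfun \<Longrightarrow> dd v (\<lambda>p. c * f p) = (\<lambda>p. c * dd v f p)"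
  using dd_mult[OF pf_const, of f v c] by simp

lemma dd_commute: "f \<in> polyfun \<Longrightarrow> dd v (dd w f) = dd w (dd v f)"
  by (induction rule: polyfun.induct)
    (auto simp: dd_add dd_mult polyfun_dd polyfun_intros fun_eq_iff algebra_simps)

text \<open>Both sides obey the sum and Leibniz rules in \<open>f\<close> and agree on constants and
  coordinates.\<close>

lemma dd_linear:
  "f \<in> polyfun \<Longrightarrow> dd v f p = (\<Sum>i\<in>UNIV. fst v $ i * dd (axis i 1, 0) f p)
      + (\<Sum>i\<in>UNIV. snd v $ i * dd (0, axis i 1) f p)"
proof (induction rule: polyfun.induct)
  case (pf_mult f g)
  then show ?case
    by (simp add: dd_mult sum.distrib sum_distrib_left sum_distrib_right algebra_simps)
qed (simp_all add: dd_add axis_def sum.distrib distrib_left if_distrib[of "(*) _"] cong: if_cong)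

text \<open>Every point is joined to the origin by a line along which the derivative
  vanishes.\<close>

lemma dd_all_0_imp_const:
  assumes "f \<in> polyfun" "\<And>v. dd v f = (\<lambda>p. 0)"
  shows "\<exists>c. f = (\<lambda>p. c)"
proof -
  have "f q = f 0" for q
  proof -
    have "((\<lambda>t. f (line 0 q t)) has_field_derivative 0) (at t)" for t
      using polyfun_has_dd[OF assms(1), of 0 q t] by (simp add: assms(2))
    then have "\<exists>c. \<forall>t\<in>UNIV. f (line 0 q t) = c"
      by (intro has_field_derivative_zero_constant) auto
    then have "f (line 0 q 1) = f (line 0 q 0)" by (metis UNIV_I)
    then show ?thesis using line_diff[of 0 q] by simp
  qed
  then show ?thesis by (intro exI[of _ "f 0"]) auto
qed

text \<open>Degree below \<open>n\<close>, expressed without monomials: all \<open>n\<close>-fold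
  directional derivatives vanish. Differentiating then lowers the bound by definition.\<close>

fun deg_lt :: "nat \<Rightarrow> ('n::finite) fn \<Rightarrow> bool" where
  "deg_lt 0 f \<longleftrightarrow> f = (\<lambda>p. 0)"
| "deg_lt (Suc n) f \<longleftrightarrow> (\<forall>v. deg_lt n (dd v f))"

lemma deg_lt_0: "deg_lt n (\<lambda>p. 0)"
  by (induction n) auto

lemma deg_lt_mono: "deg_lt n f \<Longrightarrow> n \<le> m \<Longrightarrow> deg_lt m f"
proof (induction n f arbitrary: m rule: deg_lt.induct)
  case (2 n f)
  then show ?case by (cases m) auto
qed (auto simp: deg_lt_0)

lemma deg_lt_add:
  "f \<in> polyfun \<Longrightarrow> g \<in> polyfun \<Longrightarrow> deg_lt n f \<Longrightarrow> deg_lt n g \<Longrightarrow> deg_lt n (\<lambda>p. f p + g p)"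
  by (induction n arbitrary: f g) (auto simp: dd_add polyfun_dd)

text \<open>Induction on \<open>n + m\<close> by the Leibniz rule. The bound is not sharp, but only
  the existence of some bound matters for \<open>polyfun_deg\<close>.\<close>

lemma deg_lt_mult:
  "f \<in> polyfun \<Longrightarrow> g \<in> polyfun \<Longrightarrow> deg_lt n f \<Longrightarrow> deg_lt m g \<Longrightarrow> deg_lt (n + m) (\<lambda>p. f p * g p)"
proof (induction "n + m" arbitrary: n m f g)
  case (Suc k)
  show ?case
  proof (cases "n = 0 \<or> m = 0")
    case True
    then show ?thesis using Suc.prems by (auto simp: deg_lt_0)
  next
    case False
    then obtain n' m' where nm: "n = Suc n'" "m = Suc m'"
      by (metis not0_implies_Suc)
    have "deg_lt n' (dd v f)" "deg_lt m' (dd v g)" for v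
      using Suc.prems nm by (simp_all only: deg_lt.simps)
    then have "deg_lt (n' + m) (\<lambda>p. dd v f p * g p)" "deg_lt (n + m') (\<lambda>p. f p * dd v g p)" for v
      using Suc.hyps(1)[of n' m "dd v f" g] Suc.hyps(1)[of n m' f "dd v g"] Suc.hyps(2) Suc.prems nm
      by (simp_all add: polyfun_dd del: deg_lt.simps)
    moreover have "n + m' = n' + m" using nm by simp
    ultimately have "deg_lt (n' + m) (dd v (\<lambda>p. f p * g p))" for v
      using Suc.prems(1,2) by (simp add: dd_mult deg_lt_add polyfun_intros polyfun_dd)
    then show ?thesis by (simp only: nm(1) add_Suc deg_lt.simps(2) simp_thms)
  qed
qed auto

lemma polyfun_deg: "f \<in> polyfun \<Longrightarrow> \<exists>n. deg_lt n f"
proof (induction rule: polyfun.induct)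
  case (pf_const c)
  show ?case by (intro exI[of _ 1]) simp
next
  case (pf_xcoord i)
  show ?case by (intro exI[of _ 2]) (simp add: numeral_2_eq_2)
next
  case (pf_ycoord i)
  show ?case by (intro exI[of _ 2]) (simp add: numeral_2_eq_2)
next
  case (pf_add f g)
  then obtain n m where "deg_lt n f" "deg_lt m g" by blast
  then have "deg_lt (max n m) f" "deg_lt (max n m) g" by (auto intro: deg_lt_mono)
  with pf_add show ?case by (blast intro: deg_lt_add)
next
  case (pf_mult f g)
  then show ?case by (blast intro: deg_lt_mult)
qed

text \<open>Differentiate as long as some derivative is nonzero. The degree bound drops each time,
  so this stops at a nonzero function with all derivatives zero, which is a constant.\<close>

lemma dd_closed_contains_const:
  assumes "J \<subseteq> polyfun" "\<And>f v. f \<in> J \<Longrightarrow> dd v f \<in> J" "f \<in> J" "f \<noteq> (\<lambda>p. 0)"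
  shows "\<exists>c. c \<noteq> 0 \<and> (\<lambda>p. c) \<in> J"
proof -
  have "\<exists>c. c \<noteq> 0 \<and> (\<lambda>p. c) \<in> J" if "deg_lt n f" "f \<in> J" "f \<noteq> (\<lambda>p. 0)" for n f
    using that
  proof (induction n arbitrary: f)
    case (Suc n)
    show ?case
    proof (cases "\<exists>v. dd v f \<noteq> (\<lambda>p. 0)")
      case True
      then obtain v where "dd v f \<noteq> (\<lambda>p. 0)" by blast
      moreover have "deg_lt n (dd v f)" using Suc.prems(1) by (simp only: deg_lt.simps)
      ultimately show ?thesis using Suc.IH Suc.prems(2) assms(2) by blast
    next
      case False
      then obtain c where "f = (\<lambda>p. c)"
        using dd_all_0_imp_const assms(1) Suc.prems by blast
      then show ?thesis using Suc.prems by auto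
    qed
  qed auto
  then show ?thesis using polyfun_deg assms by blast
qed

section \<open>Operators on polynomial functions\<close>

text \<open>Demanding the value 0 off \<open>polyfun\<close>, the normalisation made by
  \<open>res\<close>, lets equality of operators be tested on polynomial functions alone
  (\<open>op_eqI\<close>).\<close>

definition is_op :: "('n::finite) op \<Rightarrow> bool" where
  "is_op T \<longleftrightarrow> (\<forall>f. f \<notin> polyfun \<longrightarrow> T f = (\<lambda>p. 0)) \<and> (\<forall>f\<in>polyfun. T f \<in> polyfun) \<and>
     (\<forall>f\<in>polyfun. \<forall>g\<in>polyfun. T (\<lambda>p. f p + g p) = (\<lambda>p. T f p + T g p)) \<and>
     (\<forall>f\<in>polyfun. \<forall>c. T (\<lambda>p. c * f p) = (\<lambda>p. c * T f p))"

text \<open>This and the next two definitions name the operations occurring in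
  \<open>ring_gen\<close>, so that ring laws can be stated and used for rewriting.\<close>

definition op_mul :: "('n::finite) op \<Rightarrow> 'n op \<Rightarrow> 'n op" where
  "op_mul T U = res (T \<circ> U)"

definition op_add :: "('n::finite) op \<Rightarrow> 'n op \<Rightarrow> 'n op" where
  "op_add T U = res (\<lambda>f p. T f p + U f p)"

definition op_neg :: "('n::finite) op \<Rightarrow> 'n op" where
  "op_neg T = res (\<lambda>f p. - T f p)"

definition op_sum :: "'i set \<Rightarrow> ('i \<Rightarrow> ('n::finite) op) \<Rightarrow> 'n op" where
  "op_sum I T = res (\<lambda>f p. \<Sum>i\<in>I. T i f p)"

definition op_d :: "('n::finite) pt \<Rightarrow> 'n op" where
  "op_d v = res (dd v)"

abbreviation op_scalar :: "complex \<Rightarrow> ('n::finite) op" where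
  "op_scalar c \<equiv> mult_op (\<lambda>p. c)"

lemma res_apply: "f \<in> polyfun \<Longrightarrow> res T f = T f"
  by (simp add: res_def)

lemma res_outside: "f \<notin> polyfun \<Longrightarrow> res T f = (\<lambda>p. 0)"
  by (simp add: res_def)

lemma op_apply:
  assumes "f \<in> polyfun"
  shows "op_mul T U f = T (U f)" "op_add T U f p = T f p + U f p" "op_neg T f p = - T f p"
    "op_sum I S f p = (\<Sum>i\<in>I. S i f p)" "op_d v f = dd v f" "mult_op h f p = h p * f p"
    "res id f = f"
  using assms by (simp_all add: res_apply op_mul_def op_add_def op_neg_def op_sum_def op_d_def mult_op_def)

lemma op_apply_fun:
  assumes "f \<in> polyfun"
  shows "op_add T U f = (\<lambda>p. T f p + U f p)" "op_neg T f = (\<lambda>p. - T f p)"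
    "op_sum I S f = (\<lambda>p. \<Sum>i\<in>I. S i f p)" "mult_op h f = (\<lambda>p. h p * f p)"
  using assms by (auto simp: op_apply)

lemma op_outside:
  assumes "f \<notin> polyfun"
  shows "op_mul T U f = (\<lambda>p. 0)" "op_add T U f = (\<lambda>p. 0)" "op_neg T f = (\<lambda>p. 0)"
    "op_sum I S f = (\<lambda>p. 0)" "op_d v f = (\<lambda>p. 0)" "mult_op h f = (\<lambda>p. 0)"
  using assms by (simp_all add: res_outside op_mul_def op_add_def op_neg_def op_sum_def op_d_def mult_op_def)

lemma is_opD:
  assumes "is_op T"
  shows "f \<notin> polyfun \<Longrightarrow> T f = (\<lambda>p. 0)" "f \<in> polyfun \<Longrightarrow> T f \<in> polyfun"
    "f \<in> polyfun \<Longrightarrow> g \<in> polyfun \<Longrightarrow> T (\<lambda>p. f p + g p) = (\<lambda>p. T f p + T g p)"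
    "f \<in> polyfun \<Longrightarrow> T (\<lambda>p. c * f p) = (\<lambda>p. c * T f p)"
  using assms by (auto simp: is_op_def)

lemma is_op_zero_fun: "is_op T \<Longrightarrow> T (\<lambda>p. 0) = (\<lambda>p. 0)"
  using is_opD(4)[of T "\<lambda>p. 0" 0] by (simp add: polyfun.intros)

lemma is_op_sum_fun:
  "is_op T \<Longrightarrow> (\<And>i. i \<in> I \<Longrightarrow> f i \<in> polyfun) \<Longrightarrow>
    T (\<lambda>p. \<Sum>i\<in>I. f i p) = (\<lambda>p. \<Sum>i\<in>I. T (f i) p)"
proof (induction I rule: infinite_finite_induct)
  case (insert i I)
  then have "f i \<in> polyfun" "(\<lambda>p. \<Sum>i\<in>I. f i p) \<in> polyfun" by (auto intro: polyfun_sum)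
  with insert show ?case by (simp add: is_opD(3)[OF insert.prems(1)])
qed (simp_all add: is_op_zero_fun)

lemma op_eqI:
  assumes "is_op T" "is_op U" "\<And>f p. f \<in> polyfun \<Longrightarrow> T f p = U f p"
  shows "T = U"
proof
  fix f show "T f = U f"
    using assms by (cases "f \<in> polyfun") (auto simp: is_opD(1))
qed

lemma is_op_id: "is_op (res id)"
  by (auto simp: is_op_def res_def polyfun_intros)

lemma is_op_mul: "is_op T \<Longrightarrow> is_op U \<Longrightarrow> is_op (op_mul T U)"
  unfolding is_op_def by (auto simp: op_outside(1) op_apply(1) polyfun_intros)

lemma is_op_add: "is_op T \<Longrightarrow> is_op U \<Longrightarrow> is_op (op_add T U)"
  unfolding is_op_def by (auto simp: op_outside op_apply_fun polyfun_intros algebra_simps)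

lemma is_op_neg: "is_op T \<Longrightarrow> is_op (op_neg T)"
  unfolding is_op_def by (auto simp: op_outside op_apply_fun polyfun_intros algebra_simps)

lemma is_op_sum: "(\<And>i. i \<in> I \<Longrightarrow> is_op (T i)) \<Longrightarrow> is_op (op_sum I T)"
  unfolding is_op_def
  by (auto simp: op_outside op_apply_fun polyfun_intros sum.distrib sum_distrib_left)

lemma is_op_mult_op: "h \<in> polyfun \<Longrightarrow> is_op (mult_op h)"
  unfolding is_op_def by (auto simp: op_outside op_apply_fun polyfun_intros algebra_simps)

lemma is_op_d: "is_op (op_d v)"
  unfolding is_op_def
  by (auto simp: op_outside op_apply polyfun_intros dd_add dd_cmult intro: polyfun_dd)

lemmas is_op_intros = is_op_id is_op_mul is_op_add is_op_neg is_op_sum is_op_mult_op is_op_d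

lemma is_op_ring_gen:
  assumes "T \<in> ring_gen S" "\<And>T. T \<in> S \<Longrightarrow> is_op T"
  shows "is_op T"
  using assms(1)
proof induction
  case (rg_add T U)
  then show ?case using is_op_add by (simp add: op_add_def)
next
  case (rg_neg T)
  then show ?case using is_op_neg by (simp add: op_neg_def)
next
  case (rg_comp T U)
  then show ?case using is_op_mul by (simp add: op_mul_def)
qed (auto simp: assms is_op_id)

lemma ring_gen_mul: "T \<in> ring_gen S \<Longrightarrow> U \<in> ring_gen S \<Longrightarrow> op_mul T U \<in> ring_gen S"
  by (simp add: op_mul_def rg_comp)

lemma ring_gen_add: "T \<in> ring_gen S \<Longrightarrow> U \<in> ring_gen S \<Longrightarrow> op_add T U \<in> ring_gen S"
  by (simp add: op_add_def rg_add)

lemma ring_gen_neg: "T \<in> ring_gen S \<Longrightarrow> op_neg T \<in> ring_gen S"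
  by (simp add: op_neg_def rg_neg)

text \<open>\<open>ring_gen\<close> has no rule for the zero operator; it is obtained as 1 -
  1.\<close>

lemma op_sum_empty: "op_sum {} T = op_add (res id) (op_neg (res id))"
  by (rule op_eqI) (auto intro!: is_op_intros simp: op_apply)

lemma op_sum_insert:
  assumes "finite I" "i \<notin> I"
  shows "op_sum (insert i I) T = op_add (T i) (op_sum I T)"
  using assms by (auto simp: fun_eq_iff op_sum_def op_add_def res_def)

lemma op_sum_cong: "I = J \<Longrightarrow> (\<And>i. i \<in> J \<Longrightarrow> T i = U i) \<Longrightarrow> op_sum I T = op_sum J U"
  by (auto simp: op_sum_def res_def fun_eq_iff)

lemma op_sum_infinite: "infinite I \<Longrightarrow> op_sum I T = op_sum {} T"
  by (auto simp: op_sum_def res_def fun_eq_iff)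

lemma ring_gen_sum: "(\<And>i. i \<in> I \<Longrightarrow> T i \<in> ring_gen S) \<Longrightarrow> op_sum I T \<in> ring_gen S"
proof (induction I rule: infinite_finite_induct)
  case (infinite I)
  then show ?case
    by (simp add: op_sum_infinite op_sum_empty ring_gen_add ring_gen_neg rg_one)
next
  case empty
  show ?case by (simp add: op_sum_empty ring_gen_add ring_gen_neg rg_one)
next
  case (insert i I)
  then show ?case by (simp add: op_sum_insert ring_gen_add)
qed

lemma ring_gen_induct [consumes 1, case_names base one add neg mul]:
  assumes "T \<in> ring_gen S" "\<And>T. T \<in> S \<Longrightarrow> P T" "P (res id)"
    "\<And>T U. T \<in> ring_gen S \<Longrightarrow> P T \<Longrightarrow> U \<in> ring_gen S \<Longrightarrow> P U \<Longrightarrow> P (op_add T U)"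
    "\<And>T. T \<in> ring_gen S \<Longrightarrow> P T \<Longrightarrow> P (op_neg T)"
    "\<And>T U. T \<in> ring_gen S \<Longrightarrow> P T \<Longrightarrow> U \<in> ring_gen S \<Longrightarrow> P U \<Longrightarrow> P (op_mul T U)"
  shows "P T"
  using assms(1)
proof (induction rule: ring_gen.induct)
  case (rg_add T U)
  then show ?case using assms(4)[of T U] by (simp add: op_add_def)
next
  case (rg_neg T)
  then show ?case using assms(5)[of T] by (simp add: op_neg_def)
next
  case (rg_comp T U)
  then show ?case using assms(6)[of T U] by (simp add: op_mul_def)
qed (use assms in auto)

lemma ring_gen_subset:
  assumes "S \<subseteq> ring_gen S'"
  shows "ring_gen S \<subseteq> ring_gen S'"
proof
  fix T assume "T \<in> ring_gen S"
  then show "T \<in> ring_gen S'"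
    by (induction rule: ring_gen_induct)
      (use assms in \<open>auto intro: ring_gen_mul ring_gen_add ring_gen_neg rg_one\<close>)
qed

lemma ring_gen_lincomb:
  assumes "scalars \<subseteq> ring_gen S" "\<And>i. i \<in> I \<Longrightarrow> T i \<in> ring_gen S"
  shows "op_sum I (\<lambda>i. op_mul (op_scalar (c i)) (T i)) \<in> ring_gen S"
  using assms by (intro ring_gen_sum ring_gen_mul) (auto simp: scalars_def)

section \<open>Multiplications and derivatives in the three Weyl algebras\<close>

lemma mult_op_mult:
  "h \<in> polyfun \<Longrightarrow> h' \<in> polyfun \<Longrightarrow> mult_op (\<lambda>p. h p * h' p) = op_mul (mult_op h) (mult_op h')"
  by (rule op_eqI) (auto intro!: is_op_intros polyfun_intros simp: op_apply op_apply_fun polyfun_intros)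

lemma mult_op_add:
  "h \<in> polyfun \<Longrightarrow> h' \<in> polyfun \<Longrightarrow> mult_op (\<lambda>p. h p + h' p) = op_add (mult_op h) (mult_op h')"
  by (rule op_eqI) (auto intro!: is_op_intros polyfun_intros simp: op_apply algebra_simps)

lemma scalars_in: "scalars \<subseteq> weyl_full" "scalars \<subseteq> weyl_V" "scalars \<subseteq> weyl_Vdual"
  by (auto simp: weyl_full_def weyl_V_def weyl_Vdual_def intro: rg_base)

lemma coords_in:
  "mult_op (\<lambda>p. fst p $ i) \<in> weyl_V" "op_d (axis i 1, 0) \<in> weyl_V"
  "mult_op (\<lambda>p. snd p $ i) \<in> weyl_Vdual" "op_d (0, axis i 1) \<in> weyl_Vdual"
  by (auto simp: weyl_V_def weyl_Vdual_def op_d_def simp flip: dx_op_eq dy_op_eq intro!: rg_base)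

lemma weyl_V_subset: "weyl_V \<subseteq> weyl_full" and weyl_Vdual_subset: "weyl_Vdual \<subseteq> weyl_full"
  unfolding weyl_V_def weyl_Vdual_def weyl_full_def
  by (rule ring_gen_subset; auto intro: rg_base)+

lemma scalar_in: "op_scalar c \<in> weyl_full" "op_scalar c \<in> weyl_V" "op_scalar c \<in> weyl_Vdual"
  using scalars_in by (auto simp: scalars_def)

text \<open>A matrix turns a coordinate into a linear form and a basis derivative into one along
  some other vector. This lemma and the next three keep the results inside the algebra of the same
  factor.\<close>

lemma mult_op_lin_x: "mult_op (\<lambda>p. \<Sum>i\<in>UNIV. c i * fst p $ i) \<in> weyl_V"
proof -
  have "mult_op (\<lambda>p. \<Sum>i\<in>UNIV. c i * fst p $ i) =
      op_sum UNIV (\<lambda>i. op_mul (op_scalar (c i)) (mult_op (\<lambda>p. fst p $ i)))" (is "?l = ?r")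
  proof (rule op_eqI)
    show "is_op ?l" by (intro is_op_intros polyfun_intros)
    show "is_op ?r" by (intro is_op_intros polyfun_intros)
    fix f :: "'a fn" and p assume f: "f \<in> polyfun"
    then have "(\<lambda>p. fst p $ i * f p) \<in> polyfun" for i by (intro polyfun_intros)
    with f show "?l f p = ?r f p"
      by (simp add: op_apply op_apply_fun sum_distrib_right mult.assoc)
  qed
  also have "\<dots> \<in> weyl_V"
    unfolding weyl_V_def
    by (rule ring_gen_lincomb) (use coords_in scalars_in in \<open>simp_all add: weyl_V_def\<close>)
  finally show ?thesis .
qed

lemma mult_op_lin_y: "mult_op (\<lambda>p. \<Sum>i\<in>UNIV. c i * snd p $ i) \<in> weyl_Vdual"
proof -
  have "mult_op (\<lambda>p. \<Sum>i\<in>UNIV. c i * snd p $ i) =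
      op_sum UNIV (\<lambda>i. op_mul (op_scalar (c i)) (mult_op (\<lambda>p. snd p $ i)))" (is "?l = ?r")
  proof (rule op_eqI)
    show "is_op ?l" by (intro is_op_intros polyfun_intros)
    show "is_op ?r" by (intro is_op_intros polyfun_intros)
    fix f :: "'a fn" and p assume f: "f \<in> polyfun"
    then have "(\<lambda>p. snd p $ i * f p) \<in> polyfun" for i by (intro polyfun_intros)
    with f show "?l f p = ?r f p"
      by (simp add: op_apply op_apply_fun sum_distrib_right mult.assoc)
  qed
  also have "\<dots> \<in> weyl_Vdual"
    unfolding weyl_Vdual_def
    by (rule ring_gen_lincomb) (use coords_in scalars_in in \<open>simp_all add: weyl_Vdual_def\<close>)
  finally show ?thesis .
qed

lemma op_d_x: "op_d (u, 0) \<in> weyl_V"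
proof -
  have "op_d (u, 0) = op_sum UNIV (\<lambda>i. op_mul (op_scalar (u $ i)) (op_d (axis i 1, 0)))" (is "?l = ?r")
  proof (rule op_eqI)
    show "is_op ?l" by (rule is_op_d)
    show "is_op ?r" by (intro is_op_intros polyfun_intros)
    fix f :: "'a fn" and p assume "f \<in> polyfun"
    then show "?l f p = ?r f p"
      using dd_linear[of f "(u, 0)" p] by (simp add: op_apply polyfun_dd)
  qed
  also have "\<dots> \<in> weyl_V"
    unfolding weyl_V_def
    by (rule ring_gen_lincomb) (use coords_in scalars_in in \<open>simp_all add: weyl_V_def\<close>)
  finally show ?thesis .
qed

lemma op_d_y: "op_d (0, u) \<in> weyl_Vdual"
proof -
  have "op_d (0, u) = op_sum UNIV (\<lambda>i. op_mul (op_scalar (u $ i)) (op_d (0, axis i 1)))" (is "?l = ?r")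
  proof (rule op_eqI)
    show "is_op ?l" by (rule is_op_d)
    show "is_op ?r" by (intro is_op_intros polyfun_intros)
    fix f :: "'a fn" and p assume "f \<in> polyfun"
    then show "?l f p = ?r f p"
      using dd_linear[of f "(0, u)" p] by (simp add: op_apply polyfun_dd)
  qed
  also have "\<dots> \<in> weyl_Vdual"
    unfolding weyl_Vdual_def
    by (rule ring_gen_lincomb) (use coords_in scalars_in in \<open>simp_all add: weyl_Vdual_def\<close>)
  finally show ?thesis .
qed

lemma op_d_in: "op_d v \<in> weyl_full"
proof -
  have "op_d v = op_add (op_d (fst v, 0)) (op_d (0, snd v))"
    by (rule op_eqI)
      (auto intro!: is_op_intros simp: op_apply dd_linear[of _ v] dd_linear[of _ "(0, snd v)"] dd_linear[of _ "(fst v, 0)"])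
  moreover have "op_d (fst v, 0) \<in> weyl_full" "op_d (0, snd v) \<in> weyl_full"
    using op_d_x op_d_y weyl_V_subset weyl_Vdual_subset by auto
  ultimately show ?thesis by (simp add: weyl_full_def ring_gen_add)
qed

lemma mult_op_in: "h \<in> polyfun \<Longrightarrow> mult_op h \<in> weyl_full"
proof (induction rule: polyfun.induct)
  case (pf_const c)
  show ?case by (rule scalar_in)
next
  case (pf_xcoord i)
  show ?case using coords_in weyl_V_subset by blast
next
  case (pf_ycoord i)
  show ?case using coords_in weyl_Vdual_subset by blast
next
  case (pf_add f g)
  then show ?case by (simp add: weyl_full_def mult_op_add ring_gen_add)
next
  case (pf_mult f g)
  then show ?case by (simp add: weyl_full_def mult_op_mult ring_gen_mul)
qed

lemma weyl_gen_cases: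
  assumes "T \<in> scalars \<union> range (\<lambda>i. mult_op (\<lambda>p. fst p $ i)) \<union> range dx_op
                        \<union> range (\<lambda>i. mult_op (\<lambda>p. snd p $ i)) \<union> range dy_op"
  obtains h where "T = mult_op h" "h \<in> polyfun" | v where "T = op_d v"
  using assms by (auto simp: scalars_def dx_op_eq dy_op_eq intro: polyfun_intros simp flip: op_d_def)

lemma is_op_weyl: "T \<in> weyl_full \<Longrightarrow> is_op T"
  unfolding weyl_full_def
  by (erule is_op_ring_gen) (erule weyl_gen_cases; simp add: is_op_mult_op is_op_d)

section \<open>Tensor decomposition and the action of matrices\<close>

lemma op_mul_assoc: "is_op U \<Longrightarrow> is_op X \<Longrightarrow> op_mul (op_mul T U) X = op_mul T (op_mul U X)"
proof
  fix f assume "is_op U" "is_op X"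
  then show "op_mul (op_mul T U) X f = op_mul T (op_mul U X) f"
    by (cases "f \<in> polyfun") (simp_all add: op_apply op_outside is_opD)
qed

lemma op_mul_add_left: "is_op X \<Longrightarrow> op_mul (op_add T U) X = op_add (op_mul T X) (op_mul U X)"
  by (auto simp: fun_eq_iff op_mul_def op_add_def res_def is_opD)

lemma op_mul_add_right:
  "is_op T \<Longrightarrow> is_op U \<Longrightarrow> is_op X \<Longrightarrow> op_mul X (op_add T U) = op_add (op_mul X T) (op_mul X U)"
  by (rule op_eqI) (auto intro!: is_op_intros simp: op_apply op_apply_fun is_opD is_opD(3)[of X])

text \<open>The operators commuting with a fixed linear \<open>U\<close> form a ring, so generators
  suffice.\<close>

lemma ring_gen_commute_aux:
  assumes "T \<in> ring_gen S" "is_op U" "\<And>T. T \<in> S \<Longrightarrow> is_op T"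
    "\<And>T. T \<in> S \<Longrightarrow> op_mul T U = op_mul U T"
  shows "op_mul T U = op_mul U T"
  using assms(1)
proof (induction rule: ring_gen_induct)
  case (base T)
  then show ?case using assms by blast
next
  case one
  show ?case using assms(2) by (auto intro!: op_eqI is_op_intros simp: op_apply is_opD)
next
  case (add T X)
  moreover have "is_op T" "is_op X" using add is_op_ring_gen assms(3) by blast+
  ultimately show ?case using assms(2) by (simp add: op_mul_add_left op_mul_add_right)
next
  case (neg T)
  have T: "is_op T" using neg is_op_ring_gen assms(3) by blast
  have "T (U f) = U (T f)" if "f \<in> polyfun" for f
    using fun_cong[OF neg.IH, of f] that by (simp add: op_apply)
  then show ?case using T assms(2) is_opD(4)[OF assms(2), of _ "-1"]
    by (auto intro!: op_eqI is_op_intros simp: op_apply op_apply_fun is_opD)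
next
  case (mul T X)
  then have "is_op T" "is_op X" using is_op_ring_gen assms(3) by blast+
  then show ?case using mul assms(2) by (metis op_mul_assoc)
qed

lemma ring_gen_commute:
  assumes "T \<in> ring_gen S" "U \<in> ring_gen S'"
    "\<And>T. T \<in> S \<Longrightarrow> is_op T" "\<And>U. U \<in> S' \<Longrightarrow> is_op U"
    "\<And>T U. T \<in> S \<Longrightarrow> U \<in> S' \<Longrightarrow> op_mul T U = op_mul U T"
  shows "op_mul T U = op_mul U T"
proof -
  \<comment> \<open>First \<open>U\<close> runs over its ring with a generator \<open>X\<close> held
    fixed; then the roles are exchanged.\<close>
  have "op_mul U X = op_mul X U" if "X \<in> S" for X
    using assms(2) by (rule ring_gen_commute_aux) (use that assms in auto)
  then show ?thesis
    using ring_gen_commute_aux[of T S U] assms is_op_ring_gen by metis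
qed

lemma weyl_V_gen_cases:
  assumes "T \<in> scalars \<union> range (\<lambda>i. mult_op (\<lambda>p. fst p $ i)) \<union> range dx_op"
  obtains c where "T = op_scalar c" | i where "T = mult_op (\<lambda>p. fst p $ i)"
    | i where "T = op_d (axis i 1, 0)"
  using assms by (auto simp: scalars_def dx_op_eq simp flip: op_d_def)

lemma weyl_Vdual_gen_cases:
  assumes "T \<in> scalars \<union> range (\<lambda>i. mult_op (\<lambda>p. snd p $ i)) \<union> range dy_op"
  obtains c where "T = op_scalar c" | i where "T = mult_op (\<lambda>p. snd p $ i)"
    | i where "T = op_d (0, axis i 1)"
  using assms by (auto simp: scalars_def dy_op_eq simp flip: op_d_def)

lemma is_op_weyl_gen:
  "T \<in> scalars \<union> range (\<lambda>i. mult_op (\<lambda>p. fst p $ i)) \<union> range dx_op \<Longrightarrow> is_op T"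
  "T \<in> scalars \<union> range (\<lambda>i. mult_op (\<lambda>p. snd p $ i)) \<union> range dy_op \<Longrightarrow> is_op T"
   apply (erule weyl_V_gen_cases; simp add: is_op_mult_op is_op_d polyfun.intros)
  apply (erule weyl_Vdual_gen_cases; simp add: is_op_mult_op is_op_d polyfun.intros)
  done

lemma op_mult_commute:
  "h \<in> polyfun \<Longrightarrow> h' \<in> polyfun \<Longrightarrow> op_mul (mult_op h) (mult_op h') = op_mul (mult_op h') (mult_op h)"
  by (auto intro!: op_eqI is_op_intros polyfun_intros simp: op_apply op_apply_fun polyfun_intros)

lemma op_d_commute: "op_mul (op_d v) (op_d w) = op_mul (op_d w) (op_d v)"
  by (auto intro!: op_eqI is_op_intros simp: op_apply polyfun_dd dd_commute)

lemma op_mult_d_commute: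
  assumes "h \<in> polyfun" "dd v h = (\<lambda>p. 0)"
  shows "op_mul (mult_op h) (op_d v) = op_mul (op_d v) (mult_op h)"
  using assms
  by (auto intro!: op_eqI is_op_intros polyfun_intros
      simp: op_apply polyfun_dd dd_mult op_apply_fun polyfun_intros)

text \<open>Coordinates of one factor are constant along the directions of the other, so the
  generators commute pairwise.\<close>

lemma weyl_commute:
  assumes "T \<in> weyl_V" "U \<in> weyl_Vdual"
  shows "op_mul T U = op_mul U T"
  using assms unfolding weyl_V_def weyl_Vdual_def
proof (rule ring_gen_commute)
  fix T U :: "'a op"
  assume "T \<in> scalars \<union> range (\<lambda>i. mult_op (\<lambda>p. fst p $ i)) \<union> range dx_op"
    "U \<in> scalars \<union> range (\<lambda>i. mult_op (\<lambda>p. snd p $ i)) \<union> range dy_op"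
  then show "op_mul T U = op_mul U T"
    by (elim weyl_V_gen_cases weyl_Vdual_gen_cases)
      (auto intro!: op_mult_commute op_d_commute op_mult_d_commute op_mult_d_commute[symmetric]
        intro: polyfun.intros)
qed (erule is_op_weyl_gen)+

text \<open>The image of the tensor product of \<open>weyl_V\<close> and \<open>weyl_Vdual\<close>
  under multiplication: all finite nonempty sums of pure tensors.\<close>

inductive_set tensor_ops :: "('n::finite) op set" where
  tensor_base: "a \<in> weyl_V \<Longrightarrow> b \<in> weyl_Vdual \<Longrightarrow> op_mul a b \<in> tensor_ops"
| tensor_add: "T \<in> tensor_ops \<Longrightarrow> U \<in> tensor_ops \<Longrightarrow> op_add T U \<in> tensor_ops"

lemma is_op_weyl_V: "T \<in> weyl_V \<Longrightarrow> is_op T" and is_op_weyl_Vdual: "T \<in> weyl_Vdual \<Longrightarrow> is_op T"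
  using weyl_V_subset weyl_Vdual_subset is_op_weyl by blast+

lemma is_op_tensor: "T \<in> tensor_ops \<Longrightarrow> is_op T"
  by (induction rule: tensor_ops.induct) (auto intro: is_op_intros is_op_weyl_V is_op_weyl_Vdual)

lemma id_in_weyl: "res id \<in> weyl_V" "res id \<in> weyl_Vdual"
  by (auto simp: weyl_V_def weyl_Vdual_def rg_one)

lemma op_mul_id_right: "is_op T \<Longrightarrow> op_mul T (res id) = T"
  by (rule op_eqI) (auto intro!: is_op_intros simp: op_apply)

lemma op_mul_id_left: "is_op T \<Longrightarrow> op_mul (res id) T = T"
  by (rule op_eqI) (auto intro!: is_op_intros simp: op_apply is_opD)

lemma weyl_V_tensor: "a \<in> weyl_V \<Longrightarrow> a \<in> tensor_ops"
  using tensor_base[OF _ id_in_weyl(2), of a] by (simp add: op_mul_id_right is_op_weyl_V)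

lemma weyl_Vdual_tensor: "b \<in> weyl_Vdual \<Longrightarrow> b \<in> tensor_ops"
  using tensor_base[OF id_in_weyl(1), of b] by (simp add: op_mul_id_left is_op_weyl_Vdual)

text \<open>By \<open>weyl_commute\<close>, \<open>(a b)(c d) = (a c)(b d)\<close>.\<close>

lemma tensor_mul:
  assumes "T \<in> tensor_ops" "U \<in> tensor_ops"
  shows "op_mul T U \<in> tensor_ops"
  using assms(1)
proof induction
  case (tensor_base a b)
  show ?case using assms(2)
  proof induction
    case (tensor_base c d)
    note ops = is_op_weyl_V[OF \<open>a \<in> _\<close>] is_op_weyl_V[OF \<open>c \<in> _\<close>]
      is_op_weyl_Vdual[OF \<open>b \<in> _\<close>] is_op_weyl_Vdual[OF \<open>d \<in> _\<close>]
    have "op_mul (op_mul a b) (op_mul c d) = op_mul a (op_mul (op_mul b c) d)"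
      using ops by (simp add: op_mul_assoc is_op_mul)
    also have "op_mul b c = op_mul c b"
      using weyl_commute[OF \<open>c \<in> _\<close> \<open>b \<in> _\<close>] by simp
    also have "op_mul a (op_mul (op_mul c b) d) = op_mul (op_mul a c) (op_mul b d)"
      using ops by (simp add: op_mul_assoc is_op_mul)
    finally show ?case
      using tensor_base \<open>a \<in> _\<close> \<open>b \<in> _\<close> ring_gen_mul unfolding weyl_V_def weyl_Vdual_def
      by (metis tensor_ops.tensor_base weyl_V_def weyl_Vdual_def)
  next
    case (tensor_add T U)
    with tensor_base show ?case
      by (simp add: op_mul_add_right is_op_tensor is_op_weyl_V is_op_weyl_Vdual is_op_mul tensor_ops.tensor_add)
  qed
next
  case (tensor_add T X)
  then show ?case using assms(2)
    by (simp add: op_mul_add_left is_op_tensor tensor_ops.tensor_add)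
qed

lemma weyl_full_tensor:
  assumes "T \<in> weyl_full"
  shows "T \<in> tensor_ops"
  using assms unfolding weyl_full_def
proof (induction rule: ring_gen_induct)
  case (base T)
  then show ?case
    by (auto simp: scalars_def dx_op_eq dy_op_eq coords_in scalar_in simp flip: op_d_def
        intro: weyl_V_tensor weyl_Vdual_tensor)
next
  case one
  show ?case using id_in_weyl weyl_V_tensor by blast
next
  case (add T U)
  then show ?case by (simp add: tensor_add)
next
  case (neg T)
  have "is_op T" using neg is_op_tensor by blast
  \<comment> \<open>\<open>tensor_ops\<close> has no rule for negation, but it is closed under
    products and contains the scalar -1.\<close>
  then have "op_neg T = op_mul (op_scalar (-1)) T"
    by (intro op_eqI is_op_neg is_op_mul is_op_mult_op pf_const) (simp_all add: op_apply is_opD)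
  then show ?case using neg tensor_mul scalar_in weyl_V_tensor by metis
next
  case (mul T U)
  then show ?case by (simp add: tensor_mul)
qed

section \<open>Conjugation by pairs of matrices\<close>

definition pt_mul :: "complex^'n^'n \<Rightarrow> complex^'n^'n \<Rightarrow> ('n::finite) pt \<Rightarrow> 'n pt" where
  "pt_mul m k p = (m *v fst p, transpose (matrix_inv k) *v snd p)"

text \<open>\<open>m\<close> acts on V and \<open>k\<close> contragrediently on V*. Taking
  \<open>m = k\<close> recovers the diagonal action; independent choices give the larger group that
  acts factorwise.\<close>

definition op_conj :: "complex^'n^'n \<Rightarrow> complex^'n^'n \<Rightarrow> ('n::finite) op \<Rightarrow> 'n op" where
  "op_conj m k T = res (\<lambda>f p. T (\<lambda>q. f (pt_mul m k q)) (pt_mul (matrix_inv m) (matrix_inv k) p))"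

lemma matrix_inv_unique:
  fixes A B :: "complex^'n^'n"
  assumes "A ** B = mat 1" "B ** A = mat 1"
  shows "matrix_inv A = B"
proof -
  have "A ** matrix_inv A = mat 1 \<and> matrix_inv A ** A = mat 1"
    unfolding matrix_inv_def by (rule someI[of _ B]) (use assms in simp)
  then show ?thesis
    by (metis assms(2) matrix_mul_assoc matrix_mul_lid matrix_mul_rid)
qed

lemma matrix_inv_mult [simp]:
  fixes A :: "complex^'n^'n"
  assumes "invertible A"
  shows "A ** matrix_inv A = mat 1" "matrix_inv A ** A = mat 1"
  using assms matrix_inv_unique unfolding invertible_def by metis+

lemma matrix_inv_inv [simp]:
  fixes A :: "complex^'n^'n"
  shows "invertible A \<Longrightarrow> matrix_inv (matrix_inv A) = A"
  by (intro matrix_inv_unique) auto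

lemma invertible_matrix_inv [simp]:
  fixes A :: "complex^'n^'n"
  shows "invertible A \<Longrightarrow> invertible (matrix_inv A)"
  unfolding invertible_def by (metis invertible_def matrix_inv_mult)

lemma matrix_inv_mul:
  fixes A B :: "complex^'n^'n"
  assumes "invertible A" "invertible B"
  shows "matrix_inv (A ** B) = matrix_inv B ** matrix_inv A"
  using assms
  by (intro matrix_inv_unique)
    (metis matrix_inv_mult matrix_mul_assoc matrix_mul_lid matrix_mul_rid)+

lemma matrix_inv_1 [simp]: "matrix_inv (mat 1 :: complex^'n^'n) = mat 1"
  by (intro matrix_inv_unique) auto

lemma invertible_1 [simp]: "invertible (mat 1 :: complex^'n^'n)"
  unfolding invertible_def by (rule exI[of _ "mat 1"]) simp

lemma pt_mul_mul:
  assumes "invertible k" "invertible k'"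
  shows "pt_mul m k (pt_mul m' k' p) = pt_mul (m ** m') (k ** k') p"
  using assms
  by (simp add: pt_mul_def matrix_vector_mul_assoc matrix_inv_mul matrix_transpose_mul
      del: transpose_matrix_vector)

lemma pt_mul_1 [simp]: "pt_mul (mat 1) (mat 1) p = p"
  by (simp add: pt_mul_def)

lemma pt_mul_inv [simp]:
  assumes "invertible m" "invertible k"
  shows "pt_mul (matrix_inv m) (matrix_inv k) (pt_mul m k p) = p"
    "pt_mul m k (pt_mul (matrix_inv m) (matrix_inv k) p) = p"
  using assms by (simp_all add: pt_mul_mul)

lemma polyfun_pt_mul: "f \<in> polyfun \<Longrightarrow> (\<lambda>p. f (pt_mul m k p)) \<in> polyfun"
  by (induction rule: polyfun.induct)
    (auto simp: pt_mul_def matrix_vector_mult_def intro!: polyfun_intros)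

lemma op_conj_apply:
  "f \<in> polyfun \<Longrightarrow> op_conj m k T f = (\<lambda>p. T (\<lambda>q. f (pt_mul m k q)) (pt_mul (matrix_inv m) (matrix_inv k) p))"
  by (simp add: op_conj_def res_apply)

lemma op_conj_outside: "f \<notin> polyfun \<Longrightarrow> op_conj m k T f = (\<lambda>p. 0)"
  by (simp add: op_conj_def res_outside)

lemma is_op_conj: "is_op T \<Longrightarrow> is_op (op_conj m k T)"
  unfolding is_op_def[of "op_conj m k T"]
  by (auto simp: op_conj_outside op_conj_apply polyfun_intros polyfun_pt_mul is_opD
      is_opD(3,4)[of T])

lemma op_conj_1: "is_op T \<Longrightarrow> op_conj (mat 1) (mat 1) T = T"
  by (rule op_eqI) (auto simp: op_conj_apply is_op_conj)

lemma op_conj_conj: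
  assumes "is_op T" "invertible m" "invertible k" "invertible m'" "invertible k'"
  shows "op_conj m k (op_conj m' k' T) = op_conj (m ** m') (k ** k') T"
  using assms
  by (intro op_eqI)
    (auto simp: op_conj_apply is_op_conj polyfun_pt_mul pt_mul_mul matrix_inv_mul)

lemma op_conj_mul:
  assumes "is_op T" "is_op U" "invertible m" "invertible k"
  shows "op_conj m k (op_mul T U) = op_mul (op_conj m k T) (op_conj m k U)"
  using assms
  by (intro op_eqI)
    (auto intro!: is_op_conj is_op_mul simp: op_conj_apply op_apply polyfun_pt_mul is_opD)

lemma op_conj_add:
  assumes "is_op T" "is_op U"
  shows "op_conj m k (op_add T U) = op_add (op_conj m k T) (op_conj m k U)"
  using assms
  by (intro op_eqI)
    (auto intro!: is_op_conj is_op_add simp: op_conj_apply op_apply polyfun_pt_mul)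

lemma op_conj_neg:
  assumes "is_op T"
  shows "op_conj m k (op_neg T) = op_neg (op_conj m k T)"
  using assms
  by (intro op_eqI)
    (auto intro!: is_op_conj is_op_neg simp: op_conj_apply op_apply polyfun_pt_mul)

lemma op_conj_sum:
  assumes "\<And>i. i \<in> I \<Longrightarrow> is_op (T i)"
  shows "op_conj m k (op_sum I T) = op_sum I (\<lambda>i. op_conj m k (T i))"
  using assms
  by (intro op_eqI)
    (auto intro!: is_op_conj is_op_sum simp: op_conj_apply op_apply polyfun_pt_mul)

lemma op_conj_id:
  assumes "invertible m" "invertible k"
  shows "op_conj m k (res id) = res id"
  using assms
  by (intro op_eqI)
    (auto intro!: is_op_conj is_op_id simp: op_conj_apply op_apply polyfun_pt_mul)

lemma op_conj_mult:
  assumes "h \<in> polyfun" "invertible m" "invertible k"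
  shows "op_conj m k (mult_op h) = mult_op (\<lambda>p. h (pt_mul (matrix_inv m) (matrix_inv k) p))"
  using assms
  by (intro op_eqI)
    (auto intro!: is_op_conj is_op_mult_op simp: op_conj_apply op_apply polyfun_pt_mul)

lemma pt_mul_line: "pt_mul m k (line p v t) = line (pt_mul m k p) (pt_mul m k v) t"
  by (simp add: pt_mul_def line_def matrix_vector_right_distrib vector_scalar_commute)

lemma op_conj_d:
  assumes "invertible m" "invertible k"
  shows "op_conj m k (op_d v) = op_d (pt_mul m k v)"
  using assms
  by (intro op_eqI)
    (auto intro!: is_op_conj is_op_d simp: op_conj_apply op_apply polyfun_pt_mul dd_def pt_mul_line)

text \<open>Conjugation is a ring homomorphism, so it is enough to control the generators.\<close>

lemma op_conj_ring_gen:
  assumes "T \<in> ring_gen S" "\<And>T. T \<in> S \<Longrightarrow> is_op T" "invertible m" "invertible k"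
    "\<And>T. T \<in> S \<Longrightarrow> op_conj m k T \<in> ring_gen S'"
  shows "op_conj m k T \<in> ring_gen S'"
  using assms(1)
proof (induction rule: ring_gen_induct)
  case (add T U)
  moreover have "is_op T" "is_op U" using add is_op_ring_gen assms(2) by blast+
  ultimately show ?case by (simp add: op_conj_add ring_gen_add)
next
  case (neg T)
  moreover have "is_op T" using neg is_op_ring_gen assms(2) by blast+
  ultimately show ?case by (simp add: op_conj_neg ring_gen_neg)
next
  case (mul T U)
  moreover have "is_op T" "is_op U" using mul is_op_ring_gen assms(2) by blast+
  ultimately show ?case using assms by (simp add: op_conj_mul ring_gen_mul)
qed (use assms in \<open>auto simp: op_conj_id rg_one\<close>)

lemma op_conj_ring_gen_fixed:
  assumes "T \<in> ring_gen S" "\<And>T. T \<in> S \<Longrightarrow> is_op T" "invertible m" "invertible k"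
    "\<And>T. T \<in> S \<Longrightarrow> op_conj m k T = T"
  shows "op_conj m k T = T"
  using assms(1)
proof (induction rule: ring_gen_induct)
  case (add T U)
  moreover have "is_op T" "is_op U" using add is_op_ring_gen assms(2) by blast+
  ultimately show ?case by (simp add: op_conj_add)
next
  case (neg T)
  moreover have "is_op T" using neg is_op_ring_gen assms(2) by blast+
  ultimately show ?case by (simp add: op_conj_neg)
next
  case (mul T U)
  moreover have "is_op T" "is_op U" using mul is_op_ring_gen assms(2) by blast+
  ultimately show ?case using assms by (simp add: op_conj_mul)
qed (use assms in \<open>auto simp: op_conj_id\<close>)

lemma op_conj_weyl_V:
  assumes "T \<in> weyl_V" "invertible m" "invertible k"
  shows "op_conj m k T \<in> weyl_V"
  using assms(1) unfolding weyl_V_def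
proof (rule op_conj_ring_gen)
  fix T :: "'a op"
  assume "T \<in> scalars \<union> range (\<lambda>i. mult_op (\<lambda>p. fst p $ i)) \<union> range dx_op"
  then have "op_conj m k T \<in> weyl_V"
    by (elim weyl_V_gen_cases)
      (simp_all add: op_conj_mult op_conj_d assms polyfun_intros scalar_in,
        simp_all add: pt_mul_def op_d_x matrix_vector_mult_def[of "matrix_inv m"] mult_op_lin_x)
  then show "op_conj m k T \<in> ring_gen (scalars \<union> range (\<lambda>i. mult_op (\<lambda>p. fst p $ i)) \<union> range dx_op)"
    by (simp add: weyl_V_def)
qed (erule is_op_weyl_gen | simp add: assms)+

lemma op_conj_weyl_Vdual:
  assumes "T \<in> weyl_Vdual" "invertible m" "invertible k"
  shows "op_conj m k T \<in> weyl_Vdual"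
  using assms(1) unfolding weyl_Vdual_def
proof (rule op_conj_ring_gen)
  fix T :: "'a op"
  assume "T \<in> scalars \<union> range (\<lambda>i. mult_op (\<lambda>p. snd p $ i)) \<union> range dy_op"
  then have "op_conj m k T \<in> weyl_Vdual"
    by (elim weyl_Vdual_gen_cases)
      (simp_all add: op_conj_mult op_conj_d assms polyfun_intros scalar_in,
        simp_all add: assms pt_mul_def op_d_y vector_matrix_mult_def
          mult_op_lin_y[unfolded mult.commute[of _ "snd _ $ _"]])
  then show "op_conj m k T \<in> ring_gen (scalars \<union> range (\<lambda>i. mult_op (\<lambda>p. snd p $ i)) \<union> range dy_op)"
    by (simp add: weyl_Vdual_def)
qed (erule is_op_weyl_gen | simp add: assms)+

text \<open>The pair \<open>(1, k)\<close> moves only the V* component, so it fixes the V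
  coordinates and the V directions that generate \<open>weyl_V\<close>.\<close>

lemma op_conj_weyl_V_fixed:
  assumes "T \<in> weyl_V" "invertible k"
  shows "op_conj (mat 1) k T = T"
  using assms(1) unfolding weyl_V_def
proof (rule op_conj_ring_gen_fixed)
  fix T :: "'a op"
  assume "T \<in> scalars \<union> range (\<lambda>i. mult_op (\<lambda>p. fst p $ i)) \<union> range dx_op"
  then show "op_conj (mat 1) k T = T"
    by (elim weyl_V_gen_cases)
      (simp_all add: op_conj_mult op_conj_d assms polyfun_intros pt_mul_def)
qed (erule is_op_weyl_gen | simp add: assms)+

lemma op_conj_weyl_Vdual_fixed:
  assumes "T \<in> weyl_Vdual" "invertible m"
  shows "op_conj m (mat 1) T = T"
  using assms(1) unfolding weyl_Vdual_def
proof (rule op_conj_ring_gen_fixed)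
  fix T :: "'a op"
  assume "T \<in> scalars \<union> range (\<lambda>i. mult_op (\<lambda>p. snd p $ i)) \<union> range dy_op"
  then show "op_conj m (mat 1) T = T"
    by (elim weyl_Vdual_gen_cases)
      (simp_all add: op_conj_mult op_conj_d assms polyfun_intros pt_mul_def)
qed (erule is_op_weyl_gen | simp add: assms)+

section \<open>Multiplying invariants by the discriminant into the generated ring\<close>

lemma op_sum_reindex: "bij_betw g I J \<Longrightarrow> op_sum I (\<lambda>i. T (g i)) = op_sum J T"
  using sum.reindex_bij_betw[of g I J "\<lambda>i. T i f p" for f p]
  by (auto simp: op_sum_def res_def fun_eq_iff)

lemma op_mul_sum_left: "is_op X \<Longrightarrow> op_mul (op_sum I T) X = op_sum I (\<lambda>i. op_mul (T i) X)"
  by (auto simp: op_sum_def op_mul_def res_def fun_eq_iff is_opD)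

lemma op_mul_sum_right:
  assumes "\<And>i. i \<in> I \<Longrightarrow> is_op (T i)" "is_op X"
  shows "op_mul X (op_sum I T) = op_sum I (\<lambda>i. op_mul X (T i))"
proof (rule op_eqI)
  fix f :: "'b fn" and p assume "f \<in> polyfun"
  then show "op_mul X (op_sum I T) f p = op_sum I (\<lambda>i. op_mul X (T i)) f p"
    using is_op_sum_fun[OF assms(2), of I "\<lambda>i. T i f"] assms(1)
    by (simp add: op_apply op_apply_fun is_opD)
qed (use assms in \<open>auto intro!: is_op_intros\<close>)

lemma op_sum_Sigma: "finite I \<Longrightarrow> finite J \<Longrightarrow> op_sum (I \<times> J) (\<lambda>(i, j). T i j) = op_sum I (\<lambda>i. op_sum J (T i))"
  by (auto simp: op_sum_def res_def fun_eq_iff sum.cartesian_product split_beta)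

lemma op_sum_swap: "op_sum I (\<lambda>i. op_sum J (T i)) = op_sum J (\<lambda>j. op_sum I (\<lambda>i. T i j))"
  by (auto simp: op_sum_def res_def fun_eq_iff intro: sum.swap)

lemma op_sum_const:
  assumes "is_op T"
  shows "op_sum I (\<lambda>i. T) = op_mul (op_scalar (of_nat (card I))) T"
  by (rule op_eqI) (use assms in \<open>auto intro!: is_op_intros pf_const simp: op_apply is_opD\<close>)

lemma op_scalar_mul: "is_op T \<Longrightarrow> op_mul (op_scalar c) (op_mul (op_scalar d) T) = op_mul (op_scalar (c * d)) T"
  by (intro op_eqI is_op_mul is_op_mult_op pf_const) (simp_all add: op_apply is_opD op_apply_fun polyfun_cmult)

lemma op_scalar_1: "op_scalar 1 = res id"
  by (simp add: mult_op_def id_def)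

lemma op_conj_scalar:
  "invertible m \<Longrightarrow> invertible k \<Longrightarrow> op_conj m k (op_scalar c) = op_scalar c"
  by (simp add: op_conj_mult pf_const)

lemma op_sum_add: "op_sum I (\<lambda>i. op_add (T i) (U i)) = op_add (op_sum I T) (op_sum I U)"
  by (auto simp: op_sum_def op_add_def res_def fun_eq_iff sum.distrib)

lemma weyl_full_mul: "T \<in> weyl_full \<Longrightarrow> U \<in> weyl_full \<Longrightarrow> op_mul T U \<in> weyl_full"
  by (simp add: weyl_full_def ring_gen_mul)

definition pairing :: "('n::finite) fn" where
  "pairing p = (\<Sum>i\<in>UNIV. fst p $ i * snd p $ i)"

lemma omega_op_eq: "omega_op = mult_op pairing"
  by (simp add: omega_op_def pairing_def[abs_def])

lemma polyfun_pairing: "pairing \<in> polyfun"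
  unfolding pairing_def[abs_def] by (intro polyfun_intros)

text \<open>The contragredient action of \<open>k\<close> is adjoint to \<open>k^-1\<close> under
  the pairing. Hence only \<open>k^-1 m\<close> matters, and the diagonal \<open>m = k\<close>
  leaves the pairing invariant.\<close>

lemma pairing_pt_mul: "pairing (pt_mul m k p) = pairing ((matrix_inv k ** m) *v fst p, snd p)"
proof -
  have "pairing (pt_mul m k p) =
      (\<Sum>i\<in>UNIV. \<Sum>j\<in>UNIV. (m *v fst p) $ i * (matrix_inv k $ j $ i * snd p $ j))"
    by (simp add: pairing_def pt_mul_def vector_matrix_mult_def sum_distrib_left mult.commute[of "snd p $ _"])
  also have "\<dots> = (\<Sum>j\<in>UNIV. \<Sum>i\<in>UNIV. (m *v fst p) $ i * (matrix_inv k $ j $ i * snd p $ j))"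
    by (rule sum.swap)
  also have "\<dots> = pairing (matrix_inv k *v (m *v fst p), snd p)"
    by (simp add: pairing_def matrix_vector_mult_def[of "matrix_inv k"] sum_distrib_left sum_distrib_right mult_ac)
  finally show ?thesis by (simp add: matrix_vector_mul_assoc)
qed

text \<open>Multiplying by one more linear factor combines two neighbouring coefficients, so all of
  them stay polynomial in the point.\<close>

lemma polyfun_coeff_prod:
  assumes "finite I" "\<And>i. i \<in> I \<Longrightarrow> u i \<in> polyfun"
  shows "(\<lambda>p. coeff (\<Prod>i\<in>I. [:- u i p, 1:]) j) \<in> polyfun"
  using assms
proof (induction I arbitrary: j rule: finite_induct)
  case empty
  show ?case by (simp add: pf_const)
next
  case (insert i I)
  have "(\<lambda>p. - u i p * coeff (\<Prod>i\<in>I. [:- u i p, 1:]) j +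
      (if j = 0 then 0 else coeff (\<Prod>i\<in>I. [:- u i p, 1:]) (j - 1))) \<in> polyfun"
    using insert by (cases "j = 0") (auto intro!: polyfun_diff pf_mult polyfun_uminus)
  moreover have "coeff (\<Prod>i\<in>insert i I. [:- u i p, 1:]) j = - u i p * coeff (\<Prod>i\<in>I. [:- u i p, 1:]) j +
      (if j = 0 then 0 else coeff (\<Prod>i\<in>I. [:- u i p, 1:]) (j - 1))" for p
    using insert.hyps by (simp add: coeff_pCons split: nat.split)
  ultimately show ?case by presburger
qed

text \<open>To be instantiated with the image of the representation. A group of matrices acts
  faithfully, which is what \<open>w_inj\<close> and \<open>moved_coordinate\<close> rest
  on.\<close>

locale matrix_group =
  fixes M :: "(complex^'n::finite^'n) set"
  assumes finite_M: "finite M" and one_M: "mat 1 \<in> M"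
    and mult_M: "m \<in> M \<Longrightarrow> k \<in> M \<Longrightarrow> m ** k \<in> M"
    and invertible_M: "m \<in> M \<Longrightarrow> invertible m"
    and inv_M: "m \<in> M \<Longrightarrow> matrix_inv m \<in> M"
begin

definition invs :: "'n op set \<Rightarrow> 'n op set" where
  "invs A = {T \<in> A. \<forall>m\<in>M. op_conj m m T = T}"

definition R :: "'n op set" where
  "R = ring_gen (invs weyl_V \<union> invs weyl_Vdual \<union> {omega_op})"

text \<open>The average over \<open>M \<times> M\<close> without division by the group order; such
  factors are removed at the end by \<open>R_cancel_scalar\<close>.\<close>

definition trace :: "'n op \<Rightarrow> 'n op" where
  "trace T = op_sum (M \<times> M) (\<lambda>(m, k). op_conj m k T)"

lemma bij_left: "k \<in> M \<Longrightarrow> bij_betw (\<lambda>m. k ** m) M M"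
  by (rule bij_betwI[where g = "\<lambda>m. matrix_inv k ** m"])
    (auto simp: mult_M inv_M matrix_mul_assoc invertible_M)

lemma bij_right: "k \<in> M \<Longrightarrow> bij_betw (\<lambda>m. m ** k) M M"
  by (rule bij_betwI[where g = "\<lambda>m. m ** matrix_inv k"])
    (auto simp: mult_M inv_M invertible_M simp flip: matrix_mul_assoc)

lemma card_M: "card M \<noteq> 0"
  using finite_M one_M by auto

lemma R_mul: "T \<in> R \<Longrightarrow> U \<in> R \<Longrightarrow> op_mul T U \<in> R"
  and R_add: "T \<in> R \<Longrightarrow> U \<in> R \<Longrightarrow> op_add T U \<in> R"
  and R_sum: "(\<And>i. i \<in> I \<Longrightarrow> S i \<in> R) \<Longrightarrow> op_sum I S \<in> R"
  by (auto simp: R_def intro: ring_gen_mul ring_gen_add ring_gen_sum)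

lemma R_gen: "a \<in> invs weyl_V \<Longrightarrow> a \<in> R" "b \<in> invs weyl_Vdual \<Longrightarrow> b \<in> R" "mult_op pairing \<in> R"
  by (auto simp: R_def omega_op_eq intro: rg_base)

lemma R_scalar: "op_scalar c \<in> R"
  by (rule R_gen) (auto simp: invs_def scalar_in op_conj_scalar invertible_M)

lemma R_cancel_scalar:
  assumes "c \<noteq> 0" "is_op T" "op_mul (op_scalar c) T \<in> R"
  shows "T \<in> R"
proof -
  have "op_mul (op_scalar (1 / c)) (op_mul (op_scalar c) T) \<in> R"
    using assms R_mul R_scalar by blast
  then show ?thesis
    using assms by (simp add: op_scalar_mul op_scalar_1 op_mul_id_left)
qed

lemma invs_mul:
  assumes "T \<in> invs weyl_full" "U \<in> invs weyl_full"
  shows "op_mul T U \<in> invs weyl_full"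
  using assms
  by (auto simp: invs_def op_conj_mul is_op_weyl invertible_M) (simp add: weyl_full_def ring_gen_mul)

text \<open>The easy inclusion: the generators are invariant under the diagonal, and invariants form
  a ring.\<close>

lemma R_subset_invs: "R \<subseteq> invs weyl_full"
proof
  fix T assume "T \<in> R"
  then show "T \<in> invs weyl_full"
    unfolding R_def
  proof (induction rule: ring_gen_induct)
    case (base T)
    have "op_conj m m (mult_op pairing) = mult_op pairing" if "m \<in> M" for m
      using that
      by (simp add: op_conj_mult polyfun_pairing invertible_M pairing_pt_mul)
    then have "omega_op \<in> invs weyl_full"
      by (simp add: invs_def omega_op_eq mult_op_in polyfun_pairing)
    then show ?case using base weyl_V_subset weyl_Vdual_subset by (auto simp: invs_def)
  next
    case one
    show ?case using id_in_weyl weyl_V_subset by (auto simp: invs_def op_conj_id invertible_M)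
  next
    case (add T U)
    then show ?case
      by (auto simp: invs_def op_conj_add is_op_weyl) (simp add: weyl_full_def ring_gen_add)
  next
    case (neg T)
    then show ?case
      by (auto simp: invs_def op_conj_neg is_op_weyl) (simp add: weyl_full_def ring_gen_neg)
  next
    case (mul T U)
    then show ?case by (simp add: invs_mul)
  qed
qed

lemma sum_weyl_V_in:
  assumes "a \<in> weyl_V"
  shows "op_sum M (\<lambda>m. op_conj m (mat 1) a) \<in> invs weyl_V"
proof -
  have a: "is_op a" using assms is_op_weyl_V by blast
  have "op_conj k k (op_sum M (\<lambda>m. op_conj m (mat 1) a)) = op_sum M (\<lambda>m. op_conj m (mat 1) a)"
    if k: "k \<in> M" for k
  proof -
    \<comment> \<open>\<open>(k, k)(m, 1) = (k m, 1)(1, k)\<close>, and \<open>(1, k)\<close> acts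
      trivially on \<open>weyl_V\<close>.\<close>
    have "op_conj k k (op_conj m (mat 1) a) = op_conj (k ** m) (mat 1) (op_conj (mat 1) k a)"
      if "m \<in> M" for m
      using that k a by (simp add: op_conj_conj invertible_M mult_M)
    then have "op_conj k k (op_conj m (mat 1) a) = op_conj (k ** m) (mat 1) a" if "m \<in> M" for m
      using that assms k by (simp add: op_conj_weyl_V_fixed invertible_M)
    then have "op_conj k k (op_sum M (\<lambda>m. op_conj m (mat 1) a)) = op_sum M (\<lambda>m. op_conj (k ** m) (mat 1) a)"
      using a by (simp add: op_conj_sum is_op_conj cong: op_sum_cong)
    also have "\<dots> = op_sum M (\<lambda>m. op_conj m (mat 1) a)"
      by (rule op_sum_reindex[OF bij_left[OF k]])
    finally show ?thesis .
  qed
  moreover have "op_sum M (\<lambda>m. op_conj m (mat 1) a) \<in> weyl_V"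
    unfolding weyl_V_def
    by (rule ring_gen_sum, unfold weyl_V_def[symmetric])
      (use assms in \<open>simp add: op_conj_weyl_V invertible_M\<close>)
  ultimately show ?thesis by (simp add: invs_def)
qed

lemma sum_weyl_Vdual_in:
  assumes "b \<in> weyl_Vdual"
  shows "op_sum M (\<lambda>k. op_conj (mat 1) k b) \<in> invs weyl_Vdual"
proof -
  have b: "is_op b" using assms is_op_weyl_Vdual by blast
  have "op_conj k k (op_sum M (\<lambda>m. op_conj (mat 1) m b)) = op_sum M (\<lambda>m. op_conj (mat 1) m b)"
    if k: "k \<in> M" for k
  proof -
    have "op_conj k k (op_conj (mat 1) m b) = op_conj (mat 1) (k ** m) (op_conj k (mat 1) b)"
      if "m \<in> M" for m
      using that k b by (simp add: op_conj_conj invertible_M mult_M)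
    then have "op_conj k k (op_conj (mat 1) m b) = op_conj (mat 1) (k ** m) b" if "m \<in> M" for m
      using that assms k by (simp add: op_conj_weyl_Vdual_fixed invertible_M)
    then have "op_conj k k (op_sum M (\<lambda>m. op_conj (mat 1) m b)) = op_sum M (\<lambda>m. op_conj (mat 1) (k ** m) b)"
      using b by (simp add: op_conj_sum is_op_conj cong: op_sum_cong)
    also have "\<dots> = op_sum M (\<lambda>m. op_conj (mat 1) m b)"
      by (rule op_sum_reindex[OF bij_left[OF k]])
    finally show ?thesis .
  qed
  moreover have "op_sum M (\<lambda>m. op_conj (mat 1) m b) \<in> weyl_Vdual"
    unfolding weyl_Vdual_def
    by (rule ring_gen_sum, unfold weyl_Vdual_def[symmetric])
      (use assms in \<open>simp add: op_conj_weyl_Vdual invertible_M\<close>)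
  ultimately show ?thesis by (simp add: invs_def)
qed

lemma is_op_trace: "is_op T \<Longrightarrow> is_op (trace T)"
  by (auto simp: trace_def intro!: is_op_sum is_op_conj)

lemma trace_add:
  assumes "is_op T" "is_op U"
  shows "trace (op_add T U) = op_add (trace T) (trace U)"
  using assms
  by (intro op_eqI is_op_trace is_op_add)
    (simp_all add: trace_def op_apply op_conj_add split_beta sum.distrib)

text \<open>For a pure tensor \<open>a b\<close> the sum over pairs splits into a sum over
  \<open>m\<close> acting on \<open>a\<close> times a sum over \<open>k\<close> acting on
  \<open>b\<close>. Each factor is a generator of \<open>R\<close>.\<close>

lemma trace_in_R:
  assumes "T \<in> weyl_full"
  shows "trace T \<in> R"
  using weyl_full_tensor[OF assms]
proof induction
  case (tensor_base a b)
  then have ab: "is_op a" "is_op b" by (auto intro: is_op_weyl_V is_op_weyl_Vdual)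
  have "op_conj m k (op_mul a b) = op_mul (op_conj m (mat 1) a) (op_conj (mat 1) k b)"
    if "m \<in> M" "k \<in> M" for m k
  proof -
    have "op_conj m k a = op_conj m (mat 1) (op_conj (mat 1) k a)"
      "op_conj m k b = op_conj (mat 1) k (op_conj m (mat 1) b)"
      using that ab by (simp_all add: op_conj_conj invertible_M)
    then show ?thesis
      using that ab tensor_base
      by (simp add: op_conj_mul invertible_M op_conj_weyl_V_fixed op_conj_weyl_Vdual_fixed)
  qed
  then have "trace (op_mul a b) =
      op_sum (M \<times> M) (\<lambda>(m, k). op_mul (op_conj m (mat 1) a) (op_conj (mat 1) k b))"
    unfolding trace_def by (intro op_sum_cong) auto
  also have "\<dots> = op_mul (op_sum M (\<lambda>m. op_conj m (mat 1) a)) (op_sum M (\<lambda>k. op_conj (mat 1) k b))"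
    using ab finite_M
    by (simp add: op_sum_Sigma op_mul_sum_left op_mul_sum_right is_op_sum is_op_conj)
      (rule op_sum_swap)
  also have "\<dots> \<in> R"
    using tensor_base by (intro R_mul R_gen(1,2) sum_weyl_V_in sum_weyl_Vdual_in)
  finally show ?case .
next
  case (tensor_add T U)
  then show ?case by (simp add: trace_add is_op_tensor R_add)
qed

text \<open>Since \<open>T\<close> is fixed by \<open>(k, k)\<close>, the pair \<open>(m, k)\<close>
  acts on it as \<open>(m k^-1, 1)\<close>. Hence the full trace is \<open>card M\<close> times this
  partial one.\<close>

lemma partial_trace_in_R:
  assumes "T \<in> invs weyl_full"
  shows "op_sum M (\<lambda>m. op_conj m (mat 1) T) \<in> R"
proof -
  have T: "is_op T" "T \<in> weyl_full" using assms is_op_weyl by (auto simp: invs_def)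
  have "op_sum M (\<lambda>m. op_conj m k T) = op_sum M (\<lambda>m. op_conj m (mat 1) T)" if k: "k \<in> M" for k
  proof -
    have "op_conj m k T = op_conj (m ** matrix_inv k) (mat 1) T" if "m \<in> M" for m
    proof -
      have "op_conj m k T = op_conj (m ** matrix_inv k) (mat 1) (op_conj k k T)"
        using T that k
        by (simp add: op_conj_conj invertible_M mult_M inv_M flip: matrix_mul_assoc)
      then show ?thesis using assms k by (simp add: invs_def)
    qed
    then have "op_sum M (\<lambda>m. op_conj m k T) = op_sum M (\<lambda>m. op_conj (m ** matrix_inv k) (mat 1) T)"
      by (intro op_sum_cong) auto
    also have "\<dots> = op_sum M (\<lambda>m. op_conj m (mat 1) T)"
      by (rule op_sum_reindex[OF bij_right[OF inv_M[OF k]]])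
    finally show ?thesis .
  qed
  note fixed = this
  have "trace T = op_sum M (\<lambda>m. op_sum M (\<lambda>k. op_conj m k T))"
    using finite_M by (simp add: trace_def op_sum_Sigma)
  also have "\<dots> = op_sum M (\<lambda>k. op_sum M (\<lambda>m. op_conj m k T))"
    by (rule op_sum_swap)
  also have "\<dots> = op_sum M (\<lambda>k. op_sum M (\<lambda>m. op_conj m (mat 1) T))"
    by (intro op_sum_cong fixed) auto
  also have "\<dots> = op_mul (op_scalar (of_nat (card M))) (op_sum M (\<lambda>m. op_conj m (mat 1) T))"
    using T by (simp add: op_sum_const is_op_sum is_op_conj)
  finally show ?thesis
    using R_cancel_scalar[of "of_nat (card M)"] trace_in_R[OF T(2)] card_M T
    by (simp add: is_op_sum is_op_conj)
qed

text \<open>The partial trace of such an operator is \<open>card M\<close> times the operator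
  itself.\<close>

lemma mult_invariant_in_R:
  assumes "h \<in> polyfun" "\<And>m k p. m \<in> M \<Longrightarrow> k \<in> M \<Longrightarrow> h (pt_mul m k p) = h p"
  shows "mult_op h \<in> R"
proof -
  have "op_conj m k (mult_op h) = mult_op h" if "m \<in> M" "k \<in> M" for m k
    using that assms by (simp add: op_conj_mult invertible_M inv_M)
  then have "op_sum M (\<lambda>m. op_conj m (mat 1) (mult_op h)) = op_sum M (\<lambda>m. mult_op h)"
    "mult_op h \<in> invs weyl_full"
    using one_M assms by (auto intro!: op_sum_cong simp: invs_def mult_op_in)
  then have "op_mul (op_scalar (of_nat (card M))) (mult_op h) \<in> R"
    using partial_trace_in_R[of "mult_op h"] assms by (simp add: op_sum_const is_op_mult_op)
  then show ?thesis
    using R_cancel_scalar card_M is_op_mult_op[OF assms(1)] by (metis of_nat_eq_0_iff)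
qed

section \<open>The conjugates of the pairing and the polynomial having them as roots\<close>

definition w :: "complex^'n^'n \<Rightarrow> 'n fn" where
  "w m p = pairing (matrix_inv m *v fst p, snd p)"

lemma w_1: "w (mat 1) = pairing"
  by (simp add: w_def fun_eq_iff)

text \<open>For invertible \<open>m\<close> this exhibits \<open>w m\<close> as the image of the
  pairing under the pair \<open>(m, 1)\<close>: it is the \<open>\<omega>\<^sub>m\<close> of the
  overview.\<close>

lemma w_eq: "w m = (\<lambda>p. pairing (pt_mul (matrix_inv m) (mat 1) p))"
  by (simp add: w_def fun_eq_iff pairing_pt_mul)

lemma polyfun_w: "w m \<in> polyfun"
  unfolding w_eq by (intro polyfun_pt_mul polyfun_pairing)

text \<open>A pair \<open>(a, b)\<close> only permutes the indices, by
  \<open>m \<mapsto> a^-1 m b\<close>, so symmetric expressions in the \<open>w m\<close> are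
  invariant under \<open>M \<times> M\<close>.\<close>

lemma w_pt_mul:
  assumes "m \<in> M" "a \<in> M" "b \<in> M"
  shows "w m (pt_mul a b p) = w (matrix_inv a ** m ** b) p"
proof -
  have "w m (pt_mul a b p) = pairing (pt_mul (matrix_inv m ** a) b p)"
    using assms by (simp add: w_eq pt_mul_mul invertible_M)
  also have "\<dots> = w (matrix_inv a ** m ** b) p"
    using assms
    by (simp add: w_def pairing_pt_mul matrix_inv_mul matrix_mul_assoc invertible_M inv_M mult_M)
  finally show ?thesis .
qed

lemma twist_inj: "a \<in> M \<Longrightarrow> b \<in> M \<Longrightarrow> inj (\<lambda>m. matrix_inv a ** m ** b)"
proof (rule inj_on_inverseI[where g = "\<lambda>m. a ** m ** matrix_inv b"])
  fix m assume ab: "a \<in> M" "b \<in> M"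
  have "a ** (matrix_inv a ** m ** b) ** matrix_inv b = (a ** matrix_inv a) ** m ** (b ** matrix_inv b)"
    by (simp only: matrix_mul_assoc)
  then show "a ** (matrix_inv a ** m ** b) ** matrix_inv b = m"
    using ab invertible_M by simp
qed

lemma twist_bij:
  assumes "a \<in> M" "b \<in> M"
  shows "bij_betw (\<lambda>m. matrix_inv a ** m ** b) M M"
proof -
  have "inj_on (\<lambda>m. matrix_inv a ** m ** b) M"
    using twist_inj[OF assms] inj_on_subset by blast
  moreover have "(\<lambda>m. matrix_inv a ** m ** b) ` M \<subseteq> M"
    using assms by (auto simp: mult_M inv_M)
  ultimately show ?thesis by (simp add: bij_betw_def endo_inj_surj finite_M)
qed

text \<open>Testing on the dual basis vector \<open>axis i 1\<close> recovers the
  \<open>i\<close>-th coordinate of \<open>m^-1 v\<close>.\<close>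

lemma w_inj:
  assumes "m \<in> M" "k \<in> M" "w m = w k"
  shows "m = k"
proof -
  have "(matrix_inv m *v v) $ i = (matrix_inv k *v v) $ i" for v i
    using fun_cong[OF assms(3), of "(v, axis i 1)"]
    by (simp add: w_def pairing_def axis_def if_distrib[of "(*) _"] cong: if_cong)
  then have "matrix_inv m = matrix_inv k"
    by (simp add: matrix_eq vec_eq_iff)
  then show ?thesis using assms invertible_M by (metis matrix_inv_inv)
qed

text \<open>The \<open>F\<close> of the overview at the point \<open>p\<close>;
  \<open>quot_poly\<close> below is its quotient \<open>f\<close>.\<close>

definition char_poly :: "'n pt \<Rightarrow> complex poly" where
  "char_poly p = (\<Prod>m\<in>M. [:- w m p, 1:])"

definition quot_poly :: "'n pt \<Rightarrow> complex poly" where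
  "quot_poly p = (\<Prod>m\<in>M - {mat 1}. [:- w m p, 1:])"

lemma char_poly_eq: "char_poly p = [:- pairing p, 1:] * quot_poly p"
  using prod.remove[OF finite_M one_M, of "\<lambda>m. [:- w m p, 1:]"]
  by (simp only: char_poly_def quot_poly_def w_1)

lemma coeff_char_poly_in_R: "mult_op (\<lambda>p. coeff (char_poly p) j) \<in> R"
proof (rule mult_invariant_in_R)
  show "(\<lambda>p. coeff (char_poly p) j) \<in> polyfun"
    unfolding char_poly_def by (intro polyfun_coeff_prod finite_M polyfun_w)
  fix a b p assume ab: "a \<in> M" "b \<in> M"
  have "(\<Prod>m\<in>M. [:- w (matrix_inv a ** m ** b) p, 1:]) = char_poly p"
    unfolding char_poly_def
    using prod.reindex_bij_betw[OF twist_bij[OF ab], of "\<lambda>m. [:- w m p, 1:]"] .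
  then have "char_poly (pt_mul a b p) = char_poly p"
    using ab by (simp add: char_poly_def w_pt_mul)
  then show "coeff (char_poly (pt_mul a b p)) j = coeff (char_poly p) j" by simp
qed

lemma degree_quot_poly: "degree (quot_poly p) \<le> card M"
proof -
  have "degree (quot_poly p) \<le> (\<Sum>m\<in>M - {mat 1}. degree [:- w m p, 1:])"
    unfolding quot_poly_def
    using degree_prod_sum_le[of "M - {mat 1}" "\<lambda>m. [:- w m p, 1:]"] finite_M by (simp add: o_def)
  also have "\<dots> \<le> card M" using finite_M by (simp add: card_Diff1_le)
  finally show ?thesis .
qed

lemma polyfun_coeff_quot_poly: "(\<lambda>p. coeff (quot_poly p) j) \<in> polyfun"
  unfolding quot_poly_def using finite_M by (intro polyfun_coeff_prod polyfun_w) auto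

text \<open>Synthetic division of \<open>F\<close> by \<open>t - \<omega>\<close>: each coefficient
  of \<open>f\<close> is the next coefficient of \<open>F\<close> plus \<omega> times the next
  coefficient of \<open>f\<close>.\<close>

lemma coeff_quot_poly_in_R: "mult_op (\<lambda>p. coeff (quot_poly p) j) \<in> R"
proof -
  \<comment> \<open>Downward induction on \<open>j\<close>: \<open>n\<close> bounds the distance to
    the range beyond \<open>card M\<close>, where all coefficients vanish.\<close>
  have "mult_op (\<lambda>p. coeff (quot_poly p) j) \<in> R" if "card M < j + n" for n
    using that
  proof (induction n arbitrary: j)
    case 0
    then have "coeff (quot_poly p) j = 0" for p
      using degree_quot_poly[of p] by (intro coeff_eq_0) auto
    then show ?case by (simp add: R_scalar)
  next
    case (Suc n)
    have F: "(\<lambda>p. coeff (char_poly p) (Suc j)) \<in> polyfun"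
      unfolding char_poly_def by (intro polyfun_coeff_prod finite_M polyfun_w)
    have "coeff (quot_poly p) j = coeff (char_poly p) (Suc j) + pairing p * coeff (quot_poly p) (Suc j)" for p
      by (simp add: char_poly_eq)
    then have "mult_op (\<lambda>p. coeff (quot_poly p) j) =
        op_add (mult_op (\<lambda>p. coeff (char_poly p) (Suc j)))
          (op_mul (mult_op pairing) (mult_op (\<lambda>p. coeff (quot_poly p) (Suc j))))"
      by (simp only: mult_op_add mult_op_mult F polyfun_pairing polyfun_coeff_quot_poly pf_mult)
    then show ?case
      using Suc by (simp add: R_add R_mul R_gen coeff_char_poly_in_R)
  qed
  from this[of "Suc (card M)"] show ?thesis by simp
qed

text \<open>The value \<open>f(\<omega>)\<close>, equivalently the derivative of \<open>F\<close> at
  its root \<omega>.\<close>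

definition D :: "'n fn" where
  "D p = (\<Prod>m\<in>M - {mat 1}. pairing p - w m p)"

lemma poly_quot_poly: "m \<in> M \<Longrightarrow> poly (quot_poly p) (w m p) = (if m = mat 1 then D p else 0)"
  using finite_M by (auto simp: quot_poly_def poly_prod D_def w_1)

lemma polyfun_D: "D \<in> polyfun"
  unfolding D_def[abs_def] by (intro polyfun_intros polyfun_pairing polyfun_w)

lemma invs_mult_op:
  assumes "h \<in> polyfun" "\<And>m p. m \<in> M \<Longrightarrow> h (pt_mul m m p) = h p"
  shows "mult_op h \<in> invs weyl_full"
  using assms by (simp add: invs_def mult_op_in op_conj_mult invertible_M inv_M)

text \<open>Interpolation: in the sum of \<open>f(\<omega>\<^sub>m) m(c)\<close> over
  \<open>m\<close> only \<open>m = 1\<close> survives. Expanding \<open>f\<close> in powers turns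
  this sum into coefficients of \<open>f\<close> times partial traces of
  \<open>\<omega>^j c\<close>.\<close>

lemma D_mul_in_R:
  assumes c: "c \<in> invs weyl_full"
  shows "op_mul (mult_op D) c \<in> R"
proof -
  define X where "X j = op_mul (mult_op (\<lambda>p. pairing p ^ j)) c" for j
  have op: "is_op c" using c is_op_weyl by (auto simp: invs_def)
  have pp: "(\<lambda>p::'n pt. pairing p ^ j) \<in> polyfun" for j
    by (intro polyfun_intros polyfun_pairing)
  have "pairing (pt_mul m m p) = pairing p" if "m \<in> M" for m p
    using that by (simp add: pairing_pt_mul invertible_M)
  then have X: "X j \<in> invs weyl_full" for j
    unfolding X_def using c by (intro invs_mul invs_mult_op pp) auto
  then have opX: "is_op (X j)" for j using is_op_weyl by (auto simp: invs_def)
  have "op_mul (mult_op D) c = op_sum {..card M} (\<lambda>j. op_mul (mult_op (\<lambda>p. coeff (quot_poly p) j))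
      (op_sum M (\<lambda>m. op_conj m (mat 1) (X j))))" (is "?l = ?r")
  proof (rule op_eqI)
    show "is_op ?l" by (intro is_op_mul op is_op_mult_op polyfun_D)
    show "is_op ?r"
      by (intro is_op_sum is_op_mul is_op_mult_op is_op_conj opX polyfun_coeff_quot_poly)
    fix f :: "'n fn" and p assume f: "f \<in> polyfun"
    define Y where "Y m = op_conj m (mat 1) c f p" for m
    have conjX: "op_conj m (mat 1) (X j) f p = w m p ^ j * Y m" if "m \<in> M" for m j
    proof -
      have "op_conj m (mat 1) (X j) =
          op_mul (mult_op (\<lambda>p. pairing (pt_mul (matrix_inv m) (mat 1) p) ^ j)) (op_conj m (mat 1) c)"
        using that op pp by (simp add: X_def op_conj_mul op_conj_mult is_op_mult_op invertible_M)
      moreover have "op_conj m (mat 1) c f \<in> polyfun" using op f is_opD(2) is_op_conj by blast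
      ultimately show ?thesis using f by (simp add: op_apply Y_def w_eq)
    qed
    \<comment> \<open>The range of summation must not depend on \<open>p\<close> if the result is to
      be an identity of operators.\<close>
    have poly: "poly (quot_poly p) x = (\<Sum>j\<le>card M. coeff (quot_poly p) j * x ^ j)" for x
    proof -
      have "(\<Sum>j\<le>degree (quot_poly p). coeff (quot_poly p) j * x ^ j) =
          (\<Sum>j\<le>card M. coeff (quot_poly p) j * x ^ j)"
        using degree_quot_poly[of p] by (intro sum.mono_neutral_left) (auto simp: coeff_eq_0)
      then show ?thesis by (simp add: poly_altdef)
    qed
    have fS: "op_sum M (\<lambda>m. op_conj m (mat 1) (X j)) f \<in> polyfun" for j
      by (rule is_opD(2)[OF _ f]) (intro is_op_sum is_op_conj opX)
    have "?r f p = (\<Sum>j\<le>card M. coeff (quot_poly p) j * (\<Sum>m\<in>M. w m p ^ j * Y m))"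
      using f fS conjX by (simp add: op_apply)
    also have "\<dots> = (\<Sum>m\<in>M. \<Sum>j\<le>card M. coeff (quot_poly p) j * w m p ^ j * Y m)"
      by (subst sum.swap) (simp add: sum_distrib_left mult.assoc)
    also have "\<dots> = (\<Sum>m\<in>M. poly (quot_poly p) (w m p) * Y m)"
      by (simp add: poly sum_distrib_right)
    also have "\<dots> = (\<Sum>m\<in>M. if m = mat 1 then D p * Y m else 0)"
      by (rule sum.cong) (auto simp: poly_quot_poly)
    also have "\<dots> = D p * Y (mat 1)"
      using finite_M one_M by simp
    also have "\<dots> = ?l f p"
      using f op by (simp add: Y_def op_conj_1 op_apply is_opD(2))
    finally show "?l f p = ?r f p" by simp
  qed
  also have "\<dots> \<in> R"
    by (intro R_sum R_mul coeff_quot_poly_in_R partial_trace_in_R X)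
  finally show ?thesis .
qed

section \<open>The discriminant and its cofactor\<close>

definition disc :: "'n fn" where
  "disc p = (\<Prod>(m, k)\<in>{(m, k)\<in>M \<times> M. m \<noteq> k}. w m p - w k p)"

text \<open>The factors that turn \<open>D\<close> into \<open>disc\<close>. \<open>D\<close>
  singles out the index 1, which a general pair in \<open>M \<times> M\<close> moves, whereas the
  product over all ordered pairs is invariant, without a sign.\<close>

definition disc_rest :: "'n fn" where
  "disc_rest p = (\<Prod>(m, k)\<in>{(m, k)\<in>M \<times> M. m \<noteq> k \<and> m \<noteq> mat 1}. w m p - w k p)"

lemma polyfun_disc: "disc \<in> polyfun" and polyfun_disc_rest: "disc_rest \<in> polyfun"
  unfolding disc_def[abs_def] disc_rest_def[abs_def] split_beta
  by (intro polyfun_intros polyfun_w)+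

lemma disc_eq: "disc p = D p * disc_rest p"
proof -
  have "{(m, k)\<in>M \<times> M. m \<noteq> k} = Pair (mat 1) ` (M - {mat 1}) \<union> {(m, k)\<in>M \<times> M. m \<noteq> k \<and> m \<noteq> mat 1}"
    using one_M by auto
  moreover have "finite {(m, k)\<in>M \<times> M. m \<noteq> k \<and> m \<noteq> mat 1}"
    by (rule finite_subset[of _ "M \<times> M"]) (auto simp: finite_M)
  ultimately have "disc p = (\<Prod>(m, k)\<in>Pair (mat 1) ` (M - {mat 1}). w m p - w k p) * disc_rest p"
    unfolding disc_def disc_rest_def using finite_M by (simp, intro prod.union_disjoint) auto
  also have "(\<Prod>(m, k)\<in>Pair (mat 1) ` (M - {mat 1}). w m p - w k p) = D p"
    by (subst prod.reindex) (auto simp: inj_on_def D_def w_1)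
  finally show ?thesis .
qed

lemma disc_nonzero: "disc \<noteq> (\<lambda>p. 0)"
proof -
  have "(\<lambda>p. \<Prod>x\<in>{(m, k)\<in>M \<times> M. m \<noteq> k}. w (fst x) p - w (snd x) p) \<noteq> (\<lambda>p. 0)"
  proof (rule polyfun_prod_nonzero)
    fix x assume x: "x \<in> {(m, k)\<in>M \<times> M. m \<noteq> k}"
    then have "w (fst x) \<noteq> w (snd x)" using w_inj by auto
    then show "(\<lambda>p. w (fst x) p - w (snd x) p) \<noteq> (\<lambda>p. 0)" by (simp add: fun_eq_iff)
  qed (intro polyfun_diff polyfun_w)
  then show ?thesis by (simp add: disc_def[abs_def] split_beta)
qed

text \<open>The reindexing shared by \<open>disc\<close> under \<open>M \<times> M\<close> and
  \<open>disc_rest\<close> under the diagonal, whose twist fixes the index 1.\<close>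

lemma prod_differences_pt_mul:
  assumes ab: "a \<in> M" "b \<in> M" and S: "S \<subseteq> M \<times> M"
    and closed: "\<And>m k. (m, k) \<in> S \<Longrightarrow> (matrix_inv a ** m ** b, matrix_inv a ** k ** b) \<in> S"
  shows "(\<Prod>(m, k)\<in>S. w m (pt_mul a b p) - w k (pt_mul a b p)) = (\<Prod>(m, k)\<in>S. w m p - w k p)"
proof -
  let ?g = "\<lambda>(m, k). (matrix_inv a ** m ** b, matrix_inv a ** k ** b)"
  have "finite S" using S finite_M finite_subset by blast
  moreover have "inj_on ?g S"
    using twist_inj[OF ab] by (auto simp: inj_on_def)
  moreover have "?g ` S \<subseteq> S" using closed by auto
  ultimately have "bij_betw ?g S S" by (simp add: bij_betw_def endo_inj_surj)
  then have "(\<Prod>x\<in>S. (\<lambda>(m, k). w m p - w k p) (?g x)) = (\<Prod>(m, k)\<in>S. w m p - w k p)"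
    by (rule prod.reindex_bij_betw)
  moreover have "(\<Prod>(m, k)\<in>S. w m (pt_mul a b p) - w k (pt_mul a b p)) =
      (\<Prod>x\<in>S. (\<lambda>(m, k). w m p - w k p) (?g x))"
    using ab S by (intro prod.cong) (auto simp: w_pt_mul)
  ultimately show ?thesis by simp
qed

lemma disc_pt_mul:
  assumes ab: "a \<in> M" "b \<in> M"
  shows "disc (pt_mul a b p) = disc p"
  unfolding disc_def
  by (rule prod_differences_pt_mul[OF ab])
    (use ab injD[OF twist_inj[OF ab]] in \<open>auto simp: mult_M inv_M\<close>)

lemma disc_rest_pt_mul:
  assumes a: "a \<in> M"
  shows "disc_rest (pt_mul a a p) = disc_rest p"
proof -
  have "matrix_inv a ** m ** a = mat 1 \<longleftrightarrow> m = mat 1" for m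
    using inj_eq[OF twist_inj[OF a a], of m "mat 1"] a by (simp add: invertible_M)
  then show ?thesis
    unfolding disc_rest_def
    by (intro prod_differences_pt_mul[OF a a])
      (use a injD[OF twist_inj[OF a a]] in \<open>auto simp: mult_M inv_M\<close>)
qed

text \<open>The cofactor is invariant under the diagonal, so it is absorbed into \<open>c\<close>
  before applying \<open>D_mul_in_R\<close>.\<close>

lemma disc_mul_in_R:
  assumes c: "c \<in> invs weyl_full"
  shows "op_mul (mult_op disc) c \<in> R"
proof -
  have "is_op c" using c is_op_weyl by (auto simp: invs_def)
  then have "op_mul (mult_op disc) c = op_mul (mult_op D) (op_mul (mult_op disc_rest) c)"
    by (simp add: disc_eq[abs_def] mult_op_mult polyfun_D polyfun_disc_rest op_mul_assoc is_op_mult_op)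
  also have "\<dots> \<in> R"
    by (intro D_mul_in_R invs_mul invs_mult_op polyfun_disc_rest disc_rest_pt_mul c)
  finally show ?thesis .
qed

subsection \<open>Reducing the discriminant to a constant\<close>

text \<open>Values outside \<open>M \<times> M\<close>, where \<open>op_conj\<close> involves inverses of singular matrices, are
  junk; \<open>ts_cong\<close> makes them irrelevant.\<close>

inductive_set twisted_span :: "(complex^'n^'n \<Rightarrow> complex^'n^'n \<Rightarrow> 'n op) set" where
  ts_base: "c \<in> weyl_full \<Longrightarrow> d \<in> weyl_full \<Longrightarrow>
     (\<lambda>m k. op_mul c (op_mul (mult_op disc) (op_conj m k d))) \<in> twisted_span"
| ts_add: "\<phi> \<in> twisted_span \<Longrightarrow> \<psi> \<in> twisted_span \<Longrightarrow> (\<lambda>m k. op_add (\<phi> m k) (\<psi> m k)) \<in> twisted_span"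
| ts_cong: "\<phi> \<in> twisted_span \<Longrightarrow> (\<And>m k. m \<in> M \<Longrightarrow> k \<in> M \<Longrightarrow> \<psi> m k = \<phi> m k) \<Longrightarrow> \<psi> \<in> twisted_span"

lemma is_op_twisted_span: "\<phi> \<in> twisted_span \<Longrightarrow> m \<in> M \<Longrightarrow> k \<in> M \<Longrightarrow> is_op (\<phi> m k)"
  by (induction rule: twisted_span.induct)
    (auto intro!: is_op_mul is_op_add is_op_conj is_op_mult_op polyfun_disc intro: is_op_weyl)

lemma twisted_span_mul_left:
  assumes "\<phi> \<in> twisted_span" "x \<in> weyl_full"
  shows "(\<lambda>m k. op_mul x (\<phi> m k)) \<in> twisted_span"
  using assms(1)
proof induction
  case (ts_base c d)
  then have "(\<lambda>m k. op_mul (op_mul x c) (op_mul (mult_op disc) (op_conj m k d))) \<in> twisted_span"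
    using assms by (intro twisted_span.ts_base weyl_full_mul)
  then show ?case
    by (rule ts_cong)
      (use ts_base in \<open>simp add: op_mul_assoc is_op_weyl is_op_mul is_op_conj is_op_mult_op polyfun_disc\<close>)
next
  case (ts_add \<phi> \<psi>)
  show ?case
    by (rule ts_cong[OF twisted_span.ts_add[OF ts_add(3,4)]])
      (use ts_add assms in \<open>simp add: op_mul_add_right is_op_twisted_span is_op_weyl\<close>)
next
  case (ts_cong \<phi> \<psi>)
  show ?case
    by (rule twisted_span.ts_cong[OF ts_cong(3)]) (use ts_cong in simp)
qed

text \<open>Replacing \<open>d\<close> by \<open>d x\<close> multiplies on the right by the
  conjugate of \<open>x\<close>. Compared with left multiplication this yields commutators twisted
  by \<open>(m, k)\<close>.\<close>

lemma twisted_span_mul_right: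
  assumes "\<phi> \<in> twisted_span" "x \<in> weyl_full"
  shows "(\<lambda>m k. op_mul (\<phi> m k) (op_conj m k x)) \<in> twisted_span"
  using assms(1)
proof induction
  case (ts_base c d)
  then have "(\<lambda>m k. op_mul c (op_mul (mult_op disc) (op_conj m k (op_mul d x)))) \<in> twisted_span"
    using assms by (intro twisted_span.ts_base weyl_full_mul)
  then show ?case
    by (rule ts_cong)
      (use ts_base assms in \<open>simp add: op_mul_assoc is_op_weyl is_op_mul is_op_conj is_op_mult_op
        polyfun_disc op_conj_mul invertible_M\<close>)
next
  case (ts_add \<phi> \<psi>)
  show ?case
    by (rule ts_cong[OF twisted_span.ts_add[OF ts_add(3,4)]])
      (use assms in \<open>simp add: op_mul_add_left is_op_conj is_op_weyl\<close>)
next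
  case (ts_cong \<phi> \<psi>)
  show ?case
    by (rule twisted_span.ts_cong[OF ts_cong(3)]) (use ts_cong in simp)
qed

lemma trace_reindex:
  assumes "a \<in> M" "b \<in> M"
  shows "op_sum (M \<times> M) (\<lambda>(m, k). op_conj (a ** m) (b ** k) T) = trace T"
proof -
  have "bij_betw (\<lambda>(m, k). (a ** m, b ** k)) (M \<times> M) (M \<times> M)"
    using bij_betw_map_prod[OF bij_left[OF assms(1)] bij_left[OF assms(2)]]
    by (simp add: map_prod_def)
  from op_sum_reindex[OF this, of "\<lambda>(m, k). op_conj m k T"] show ?thesis
    by (simp add: trace_def case_prod_unfold)
qed

text \<open>On a generator, summing over the group inside and outside gives the product of
  \<open>trace c\<close>, \<open>disc\<close> and \<open>trace d\<close>. The operator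
  \<open>T\<close> is carried along because \<open>disc_mul_in_R\<close> needs an invariant to the
  right of \<open>disc\<close>, here \<open>trace d\<close> times \<open>T\<close>.\<close>

lemma trace_twisted_span:
  assumes "\<phi> \<in> twisted_span" "T \<in> invs weyl_full"
  shows "op_mul (trace (op_sum (M \<times> M) (\<lambda>(m, k). \<phi> m k))) T \<in> R"
  using assms(1)
proof induction
  case (ts_base c d)
  have op: "is_op c" "is_op d" "is_op (mult_op disc)" "is_op T"
    using ts_base assms(2) by (auto simp: invs_def is_op_weyl is_op_mult_op polyfun_disc)
  have disc_inv: "op_conj a b (mult_op disc) = mult_op disc" if "a \<in> M" "b \<in> M" for a b
    using that by (simp add: op_conj_mult polyfun_disc disc_pt_mul invertible_M inv_M)
  \<comment> \<open>Conjugation by \<open>(a, b)\<close> fixes \<open>disc\<close> and shifts the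
    inner index, so the inner sum becomes \<open>trace d\<close> whatever \<open>(a, b)\<close>
    is.\<close>
  have "op_conj a b (op_sum (M \<times> M) (\<lambda>(m, k). op_mul c (op_mul (mult_op disc) (op_conj m k d)))) =
      op_mul (op_conj a b c) (op_mul (mult_op disc) (trace d))" if ab: "a \<in> M" "b \<in> M" for a b
  proof -
    have "op_conj a b (op_sum (M \<times> M) (\<lambda>(m, k). op_mul c (op_mul (mult_op disc) (op_conj m k d)))) =
        op_sum (M \<times> M) (\<lambda>x. op_conj a b (op_mul c (op_mul (mult_op disc) (op_conj (fst x) (snd x) d))))"
      using op by (simp add: op_conj_sum case_prod_unfold is_op_mul is_op_conj)
    also have "\<dots> = op_sum (M \<times> M) (\<lambda>x. op_mul (op_conj a b c) (op_mul (mult_op disc)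
        (op_conj (a ** fst x) (b ** snd x) d)))"
      using op ab
      by (intro op_sum_cong)
        (auto simp: op_conj_mul is_op_mul is_op_conj invertible_M disc_inv op_conj_conj)
    also have "\<dots> = op_mul (op_conj a b c) (op_mul (mult_op disc)
        (op_sum (M \<times> M) (\<lambda>(m, k). op_conj (a ** m) (b ** k) d)))"
      using op by (simp add: op_mul_sum_right is_op_mul is_op_conj case_prod_unfold)
    finally show ?thesis by (simp add: trace_reindex ab)
  qed
  then have "trace (op_sum (M \<times> M) (\<lambda>(m, k). op_mul c (op_mul (mult_op disc) (op_conj m k d)))) =
      op_sum (M \<times> M) (\<lambda>(a, b). op_mul (op_conj a b c) (op_mul (mult_op disc) (trace d)))"
    unfolding trace_def[of "op_sum _ _"] by (intro op_sum_cong) auto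
  also have "\<dots> = op_mul (trace c) (op_mul (mult_op disc) (trace d))"
    using op by (simp add: trace_def[of c] op_mul_sum_left is_op_mul is_op_trace case_prod_unfold)
  finally have "op_mul (trace (op_sum (M \<times> M) (\<lambda>(m, k). op_mul c (op_mul (mult_op disc) (op_conj m k d))))) T
      = op_mul (trace c) (op_mul (mult_op disc) (op_mul (trace d) T))"
    using op by (simp add: op_mul_assoc is_op_mul is_op_trace)
  also have "\<dots> \<in> R"
    using ts_base assms(2) subsetD[OF R_subset_invs trace_in_R]
    by (intro R_mul[OF trace_in_R] disc_mul_in_R invs_mul)
  finally show ?case .
next
  case (ts_add \<phi> \<psi>)
  have "is_op (op_sum (M \<times> M) (\<lambda>(m, k). \<phi> m k))" "is_op (op_sum (M \<times> M) (\<lambda>(m, k). \<psi> m k))"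
    using ts_add by (auto intro!: is_op_sum is_op_twisted_span)
  moreover have "is_op T" using assms(2) by (simp add: invs_def is_op_weyl)
  moreover have "op_sum (M \<times> M) (\<lambda>(m, k). op_add (\<phi> m k) (\<psi> m k)) =
      op_add (op_sum (M \<times> M) (\<lambda>(m, k). \<phi> m k)) (op_sum (M \<times> M) (\<lambda>(m, k). \<psi> m k))"
    by (simp add: op_sum_add case_prod_unfold)
  ultimately show ?case
    using ts_add by (simp add: trace_add op_mul_add_left R_add)
next
  case (ts_cong \<phi> \<psi>)
  have "op_sum (M \<times> M) (\<lambda>(m, k). \<psi> m k) = op_sum (M \<times> M) (\<lambda>(m, k). \<phi> m k)"
    using ts_cong(2) by (intro op_sum_cong) auto
  then show ?case using ts_cong by simp
qed

text \<open>A nontrivial pair of matrices moves some point, and coordinates separate points.\<close>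

lemma moved_coordinate:
  assumes "a \<in> M" "b \<in> M" "(a, b) \<noteq> (mat 1, mat 1)"
  obtains z where "z \<in> polyfun" "(\<lambda>p. z p - z (pt_mul (matrix_inv a) (matrix_inv b) p)) \<noteq> (\<lambda>p. 0)"
proof -
  define \<sigma> where "\<sigma> = pt_mul (matrix_inv a) (matrix_inv b)"
  have "\<exists>p. \<sigma> p \<noteq> p"
  proof (rule ccontr)
    assume "\<not> ?thesis"
    then have fixed: "\<sigma> p = p" for p by blast
    have "matrix_inv a *v v = v" for v
      using fixed[of "(v, 0)"] by (simp add: \<sigma>_def pt_mul_def)
    then have "matrix_inv a = mat 1" by (simp add: matrix_eq)
    moreover have "transpose b *v v = v" for v
      using fixed[of "(0, v)"] assms invertible_M by (simp add: \<sigma>_def pt_mul_def)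
    then have "transpose b = mat 1" by (simp add: matrix_eq del: transpose_matrix_vector)
    ultimately show False
      using assms invertible_M by (metis matrix_inv_1 matrix_inv_inv transpose_mat transpose_transpose)
  qed
  then obtain p where "\<sigma> p \<noteq> p" by blast
  then consider i where "fst p $ i \<noteq> fst (\<sigma> p) $ i" | i where "snd p $ i \<noteq> snd (\<sigma> p) $ i"
    by (metis prod_eq_iff vec_eq_iff)
  then show ?thesis
  proof cases
    case 1
    show ?thesis
      by (rule that[of "\<lambda>p. fst p $ i"], rule pf_xcoord)
        (use 1 in \<open>auto simp: \<sigma>_def dest!: fun_cong[of _ _ p]\<close>)
  next
    case 2
    show ?thesis
      by (rule that[of "\<lambda>p. snd p $ i"], rule pf_ycoord)
        (use 2 in \<open>auto simp: \<sigma>_def dest!: fun_cong[of _ _ p]\<close>)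
  qed
qed

definition delta :: "'n fn \<Rightarrow> complex^'n^'n \<Rightarrow> complex^'n^'n \<Rightarrow> 'n op" where
  "delta h m k = mult_op (if m = mat 1 \<and> k = mat 1 then h else (\<lambda>p. 0))"

text \<open>Pairs other than the identity are killed one at a time. A twisted commutator with
  \<open>z\<close> multiplies the value at each pair by a difference of two conjugates of
  \<open>z\<close>, chosen to vanish at the pair in question but not at the identity. The value
  there stays nonzero because \<open>polyfun\<close> has no zero divisors.\<close>

lemma delta_in_twisted_span:
  obtains h where "h \<in> polyfun" "h \<noteq> (\<lambda>p. 0)" "delta h \<in> twisted_span"
proof -
  have "\<exists>u. (\<forall>m\<in>M. \<forall>k\<in>M. u m k \<in> polyfun) \<and> (\<lambda>m k. mult_op (u m k)) \<in> twisted_span \<and>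
      u (mat 1) (mat 1) \<noteq> (\<lambda>p. 0) \<and> (\<forall>(m, k)\<in>S. u m k = (\<lambda>p. 0))"
    if "finite S" "S \<subseteq> M \<times> M - {(mat 1, mat 1)}" for S
    using that
  proof (induction S rule: finite_induct)
    case empty
    \<comment> \<open>The start is \<open>c = d = 1\<close>, giving the constant function with value
      \<open>disc\<close>.\<close>
    have "(\<lambda>m k. op_mul (res id) (op_mul (mult_op disc) (op_conj m k (res id)))) \<in> twisted_span"
      using id_in_weyl weyl_V_subset by (intro ts_base) auto
    then have "(\<lambda>m k. mult_op disc) \<in> twisted_span"
      by (rule ts_cong)
        (simp add: op_conj_id invertible_M op_mul_id_left op_mul_id_right is_op_mult_op polyfun_disc)
    then show ?case
      using polyfun_disc disc_nonzero by (intro exI[of _ "\<lambda>m k. disc"]) auto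
  next
    case (insert x S)
    then have "S \<subseteq> M \<times> M - {(mat 1, mat 1)}" by simp
    from insert.IH[OF this] obtain u where u: "\<forall>m\<in>M. \<forall>k\<in>M. u m k \<in> polyfun"
      "(\<lambda>m k. mult_op (u m k)) \<in> twisted_span" "u (mat 1) (mat 1) \<noteq> (\<lambda>p. 0)"
      "\<forall>(m, k)\<in>S. u m k = (\<lambda>p. 0)"
      by (elim exE conjE) (rule that)
    obtain a b where x: "x = (a, b)" by (cases x)
    with insert have ab: "a \<in> M" "b \<in> M" "(a, b) \<noteq> (mat 1, mat 1)" by auto
    obtain z where z: "z \<in> polyfun" "(\<lambda>p. z p - z (pt_mul (matrix_inv a) (matrix_inv b) p)) \<noteq> (\<lambda>p. 0)"
      using moved_coordinate[OF ab] by blast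
    \<comment> \<open>\<open>y\<close> is minus the conjugate of \<open>z\<close> by
      \<open>(a, b)\<close>, so the new factor in \<open>u'\<close> vanishes at
      \<open>(a, b)\<close>; zeros of \<open>u\<close> persist.\<close>
    define y where "y p = - z (pt_mul (matrix_inv a) (matrix_inv b) p)" for p
    define u' where "u' m k p = u m k p * (z (pt_mul (matrix_inv m) (matrix_inv k) p) + y p)" for m k p
    have y: "y \<in> polyfun"
      unfolding y_def[abs_def] using z by (intro polyfun_uminus polyfun_pt_mul)
    have zp: "(\<lambda>p. z (pt_mul m k p)) \<in> polyfun" for m k
      using z by (intro polyfun_pt_mul)
    have u': "u' m k \<in> polyfun" if "m \<in> M" "k \<in> M" for m k
      unfolding u'_def[abs_def] using u(1) that by (intro pf_mult pf_add zp y) auto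
    have "(\<lambda>m k. op_add (op_mul (mult_op (u m k)) (op_conj m k (mult_op z)))
        (op_mul (mult_op y) (mult_op (u m k)))) \<in> twisted_span"
      using u z y mult_op_in
      by (intro ts_add twisted_span_mul_left twisted_span_mul_right) auto
    then have "(\<lambda>m k. mult_op (u' m k)) \<in> twisted_span"
    proof (rule ts_cong)
      fix m k assume mk: "m \<in> M" "k \<in> M"
      have "u' m k = (\<lambda>p. u m k p * z (pt_mul (matrix_inv m) (matrix_inv k) p) + y p * u m k p)"
        by (simp add: u'_def fun_eq_iff algebra_simps)
      then show "mult_op (u' m k) = op_add (op_mul (mult_op (u m k)) (op_conj m k (mult_op z)))
        (op_mul (mult_op y) (mult_op (u m k)))"
        using mk u(1) by (simp add: op_conj_mult z(1) invertible_M mult_op_add mult_op_mult pf_mult zp y)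
    qed
    moreover have "u' (mat 1) (mat 1) \<noteq> (\<lambda>p. 0)"
    proof
      assume "u' (mat 1) (mat 1) = (\<lambda>p. 0)"
      then have "(\<lambda>p. u (mat 1) (mat 1) p * (z p - z (pt_mul (matrix_inv a) (matrix_inv b) p))) = (\<lambda>p. 0)"
        by (simp add: u'_def[abs_def] y_def)
      then show False
        using polyfun_mult_eq_0[OF bspec[OF bspec[OF u(1) one_M] one_M] polyfun_diff[OF z(1) zp]] u(3) z(2)
        by blast
    qed
    moreover have "\<forall>(m, k)\<in>insert x S. u' m k = (\<lambda>p. 0)"
      using u(4) by (auto simp: x u'_def[abs_def] y_def)
    ultimately show ?case using u' by blast
  qed
  from this[of "M \<times> M - {(mat 1, mat 1)}"] obtain u where u: "\<forall>m\<in>M. \<forall>k\<in>M. u m k \<in> polyfun"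
      "(\<lambda>m k. mult_op (u m k)) \<in> twisted_span" "u (mat 1) (mat 1) \<noteq> (\<lambda>p. 0)"
      "\<forall>(m, k)\<in>M \<times> M - {(mat 1, mat 1)}. u m k = (\<lambda>p. 0)"
    using finite_M by (auto simp del: split_paired_All)
  have "u m k = (\<lambda>p. 0)" if "m \<in> M" "k \<in> M" "\<not> (m = mat 1 \<and> k = mat 1)" for m k
    using bspec[OF u(4), of "(m, k)"] that by simp
  then have "delta (u (mat 1) (mat 1)) \<in> twisted_span"
    by (intro ts_cong[OF u(2)]) (auto simp: delta_def)
  then show ?thesis using that u(1,3) one_M by blast
qed

text \<open>At the identity the commutator of the derivative with multiplication by \<open>h\<close>
  is multiplication by \<open>dd v h\<close>; elsewhere the function stays 0.\<close>

lemma delta_dd_in_twisted_span: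
  assumes "h \<in> polyfun" "delta h \<in> twisted_span"
  shows "delta (dd v h) \<in> twisted_span"
proof -
  have zero: "op_mul (op_d v) (mult_op (\<lambda>p. 0)) = op_scalar 0" "op_mul (mult_op (\<lambda>p. 0)) T = op_scalar 0"
    if "is_op T" for T
    using that
    by (auto intro!: op_eqI is_op_intros pf_const simp: op_apply op_apply_fun is_opD pf_const)
  have "(\<lambda>m k. op_add (op_mul (op_d v) (delta h m k))
      (op_mul (op_scalar (-1)) (op_mul (delta h m k) (op_conj m k (op_d v))))) \<in> twisted_span"
    by (intro ts_add twisted_span_mul_left twisted_span_mul_right assms op_d_in scalar_in)
  then show ?thesis
  proof (rule ts_cong)
    fix m k assume mk: "m \<in> M" "k \<in> M"
    show "delta (dd v h) m k = op_add (op_mul (op_d v) (delta h m k))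
      (op_mul (op_scalar (-1)) (op_mul (delta h m k) (op_conj m k (op_d v))))" (is "?l = ?r")
    proof (rule op_eqI)
      have "is_op (delta h m k)" "is_op ?l"
        using assms by (auto simp: delta_def intro!: is_op_mult_op polyfun_dd pf_const)
      then show "is_op ?l" "is_op ?r"
        by (auto intro!: is_op_intros is_op_conj pf_const)
      fix f :: "'n fn" and p assume f: "f \<in> polyfun"
      have "op_conj m k (op_d v) f \<in> polyfun"
        by (rule is_opD(2)[OF _ f]) (intro is_op_conj is_op_d)
      with f assms show "?l f p = ?r f p"
        by (cases "m = mat 1 \<and> k = mat 1")
          (auto simp: delta_def op_apply op_apply_fun op_conj_1 is_op_d dd_mult polyfun_dd pf_mult pf_const)
    qed
  qed
qed

text \<open>A nonzero multiple of 1 is written as a sum of products of \<open>trace c\<close>,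
  \<open>disc\<close> and \<open>trace d\<close>, and then multiplied by \<open>T\<close>.\<close>

lemma invs_subset_R: "invs weyl_full \<subseteq> R"
proof
  fix T assume T: "T \<in> invs weyl_full"
  then have opT: "is_op T" by (auto simp: invs_def is_op_weyl)
  obtain h where h: "h \<in> polyfun" "h \<noteq> (\<lambda>p. 0)" "delta h \<in> twisted_span"
    using delta_in_twisted_span by blast
  have "\<exists>c. c \<noteq> 0 \<and> (\<lambda>p. c) \<in> {h \<in> polyfun. delta h \<in> twisted_span}"
    using h by (intro dd_closed_contains_const[of _ h]) (auto intro: polyfun_dd delta_dd_in_twisted_span)
  then obtain c where c: "c \<noteq> 0" "delta (\<lambda>p. c) \<in> twisted_span" by blast
  \<comment> \<open>Summing over the group leaves the value at the identity, the scalar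
    \<open>c\<close>. Its trace is the square of \<open>card M\<close> times \<open>c\<close>, which
    is cancelled at the end.\<close>
  have "op_sum (M \<times> M) (\<lambda>(m, k). delta (\<lambda>p. c) m k) = op_scalar c" (is "?l = _")
  proof (rule op_eqI)
    show "is_op ?l" by (auto simp: delta_def intro!: is_op_sum is_op_mult_op pf_const)
    fix f :: "'n fn" and p assume f: "f \<in> polyfun"
    have "?l f p = (\<Sum>x\<in>M \<times> M. if x = (mat 1, mat 1) then c * f p else 0)"
      using f by (auto simp: op_apply delta_def case_prod_unfold prod_eq_iff intro!: sum.cong)
    then show "?l f p = op_scalar c f p"
      using f one_M finite_M by (simp add: op_apply)
  qed (simp add: is_op_mult_op pf_const)
  then have "op_mul (trace (op_scalar c)) T \<in> R"
    using trace_twisted_span[OF c(2) T] by simp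
  also have "trace (op_scalar c) = op_sum (M \<times> M) (\<lambda>x. op_scalar c)"
    unfolding trace_def by (intro op_sum_cong) (auto simp: op_conj_scalar invertible_M)
  also have "op_mul (op_sum (M \<times> M) (\<lambda>x. op_scalar c)) T = op_mul (op_scalar (of_nat (card M * card M))) (op_mul (op_scalar c) T)"
    using opT by (simp add: op_sum_const is_op_mult_op pf_const op_mul_assoc card_cartesian_product)
  also have "\<dots> = op_mul (op_scalar (of_nat (card M * card M) * c)) T"
    using opT by (rule op_scalar_mul)
  finally show "T \<in> R"
    using R_cancel_scalar[of "of_nat (card M * card M) * c"] opT c(1) card_M by simp
qed

lemma invs_eq: "invs weyl_full = R"
  using invs_subset_R R_subset_invs by blast

end

section \<open>From a representation to its image\<close>

theorem theorem7p9:
  fixes W :: "('g, 'b) monoid_scheme" and \<rho> :: "'g \<Rightarrow> complex^'n::finite^'n"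
  assumes "group W" and "finite (carrier W)" and "is_rep W \<rho>"
  shows "invariants W \<rho> weyl_full =
           ring_gen (invariants W \<rho> weyl_V \<union> invariants W \<rho> weyl_Vdual \<union> {omega_op})"
proof -
  interpret W: group W by fact
  have one: "\<rho> \<one>\<^bsub>W\<^esub> = mat 1"
    and mult: "\<And>g h. g \<in> carrier W \<Longrightarrow> h \<in> carrier W \<Longrightarrow> \<rho> (g \<otimes>\<^bsub>W\<^esub> h) = \<rho> g ** \<rho> h"
    using assms(3) by (auto simp: is_rep_def)
  have inv: "\<rho> g ** \<rho> (inv\<^bsub>W\<^esub> g) = mat 1" "\<rho> (inv\<^bsub>W\<^esub> g) ** \<rho> g = mat 1"
    if "g \<in> carrier W" for g
    using that mult[of g "inv\<^bsub>W\<^esub> g"] mult[of "inv\<^bsub>W\<^esub> g" g] by (simp_all add: one)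
  then have invertible: "invertible (\<rho> g)" and matrix_inv: "matrix_inv (\<rho> g) = \<rho> (inv\<^bsub>W\<^esub> g)"
    if "g \<in> carrier W" for g
    using that matrix_inv_unique by (auto simp: invertible_def)
  \<comment> \<open>Passing to the set of matrices divides out the kernel of
    \<open>\<rho>\<close>.\<close>
  interpret matrix_group "\<rho> ` carrier W"
  proof
    show "mat 1 \<in> \<rho> ` carrier W" using one by force
    show "m ** k \<in> \<rho> ` carrier W" if "m \<in> \<rho> ` carrier W" "k \<in> \<rho> ` carrier W" for m k
      using that by (auto simp flip: mult)
  qed (use assms(2) in \<open>auto simp: invertible matrix_inv\<close>)
  \<comment> \<open>\<open>op_act\<close> feeds the inverse of \<open>g\<close> into
    \<open>fn_act\<close>, which inverts again; so the inner substitution is by \<open>g\<close> and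
    the outer one by its inverse, as in \<open>op_conj\<close>.\<close>
  have "op_act W \<rho> g T = op_conj (\<rho> g) (\<rho> g) T" if "g \<in> carrier W" for g T
  proof -
    have "pt_act W \<rho> g = pt_mul (\<rho> g) (\<rho> g)"
      "pt_act W \<rho> (inv\<^bsub>W\<^esub> g) = pt_mul (matrix_inv (\<rho> g)) (matrix_inv (\<rho> g))"
      using that by (simp_all add: pt_act_def pt_mul_def fun_eq_iff matrix_inv)
    then show ?thesis
      using that by (simp add: op_act_def fn_act_def op_conj_def)
  qed
  then have "invariants W \<rho> A = invs A" for A
    by (auto simp: invariants_def invs_def)
  then show ?thesis
    using invs_eq by (simp add: R_def)
qed

end
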